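(* Let $\gamma\in(0,1)$, $\beta>1$, $\mu,\epsilon>0$, $\mu_2$ sufficiently large, and let $(\xi,\nu)=(\xi_{c,\mu_2},\nu_{c,\mu_2})\in H^1(\mathbb R)\times H^1(\mathbb R)$, $|c|$ small, be the even solution of $$-c\,\mathcal W\xi+\mathcal Z\nu=\tfrac{\epsilon}{\gamma}\xi\nu,\qquad \xi=\tfrac{1}{1-\gamma}\Big(c\nu+\tfrac{\epsilon}{2\gamma}\nu^2\Big)$$ lying on the smooth branch in $c$ emanating from the $c=0$ solution $(\xi_{0,\mu_2},\nu_{0,\mu_2})$. Then there exist constants $\eta_1>0$ and $N_1>0$ such that $e^{\eta_1|x|}|\xi(x)|\le N_1$ and $e^{\eta_1|x|}|\nu(x)|\le N_1$ for all $x\in\mathbb R$.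
   Context: $|D|$ is the Fourier multiplier with symbol $|k|$. For $\mu_2>0$: $\mathcal W=1+\frac\beta\gamma\sqrt\mu|D|\coth(\sqrt{\mu_2}|D|)$ and $\mathcal Z=\frac1\gamma\big(1+\frac{\beta-1}{\gamma}\sqrt\mu|D|\coth(\sqrt{\mu_2}|D|)\big)$ (symbols extended by continuity at $k=0$). The $c=0$ solution $(\xi_{0,\mu_2},\nu_{0,\mu_2})$ is the even solution of $\mathcal Z\nu=\frac\epsilon\gamma\xi\nu$, $\xi=\frac{\epsilon}{2\gamma(1-\gamma)}\nu^2$ which, as $\mu_2\to\infty$, converges to $(\xi_0,\nu_0)$, with $\nu_0$ the even positive solution of $\frac{(\beta-1)\sqrt\mu}{\gamma^2}|D|\nu_0+\frac1\gamma\nu_0-\frac{\epsilon^2}{2\gamma^2(1-\gamma)}\nu_0^3=0$ and $\xi_0=\frac{\epsilon}{2\gamma(1-\gamma)}\nu_0^2$. *)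

theory Defs
  imports "HOL-Analysis.Analysis"
begin

definition test_fun :: "(real \<Rightarrow> real) \<Rightarrow> bool" where
  "test_fun \<phi> \<longleftrightarrow> (\<forall>n x. ((deriv ^^ n) \<phi>) differentiable (at x)) \<and> (\<exists>R. \<forall>x. R < \<bar>x\<bar> \<longrightarrow> \<phi> x = 0)"

definition fourier :: "(real \<Rightarrow> real) \<Rightarrow> real \<Rightarrow> complex" where
  "fourier \<phi> k = (LINT x|lborel. complex_of_real (\<phi> x) * cis (- (k * x)))"

definition fmult :: "(real \<Rightarrow> real) \<Rightarrow> (real \<Rightarrow> real) \<Rightarrow> real \<Rightarrow> real" where
  "fmult m \<phi> x = Re ((LINT k|lborel. complex_of_real (m k) * fourier \<phi> k * cis (k * x)) / complex_of_real (2 * pi))"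

definition L2 :: "(real \<Rightarrow> real) \<Rightarrow> bool" where
  "L2 f \<longleftrightarrow> f \<in> borel_measurable lborel \<and> integrable lborel (\<lambda>x. (f x)\<^sup>2)"

definition weak_deriv :: "(real \<Rightarrow> real) \<Rightarrow> (real \<Rightarrow> real) \<Rightarrow> bool" where
  "weak_deriv f g \<longleftrightarrow> (\<forall>\<phi>. test_fun \<phi> \<longrightarrow>
      (LINT x|lborel. f x * deriv \<phi> x) = - (LINT x|lborel. g x * \<phi> x))"

definition H1 :: "(real \<Rightarrow> real) \<Rightarrow> bool" where
  "H1 f \<longleftrightarrow> L2 f \<and> (\<exists>g. L2 g \<and> weak_deriv f g)"

definition h1norm :: "(real \<Rightarrow> real) \<Rightarrow> real" where
  "h1norm f = sqrt ((LINT x|lborel. (f x)\<^sup>2)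
                  + (LINT x|lborel. ((SOME g. L2 g \<and> weak_deriv f g) x)\<^sup>2))"

definition h1_has_deriv :: "real \<Rightarrow> (real \<Rightarrow> real \<Rightarrow> real) \<Rightarrow> (real \<Rightarrow> real \<Rightarrow> real) \<Rightarrow> bool" where
  "h1_has_deriv d F F' \<longleftrightarrow> (\<forall>c. \<bar>c\<bar> < d \<longrightarrow>
      ((\<lambda>h. h1norm (\<lambda>x. (F (c + h) x - F c x) / h - F' c x)) \<longlongrightarrow> 0) (at 0))"

definition h1_smooth :: "real \<Rightarrow> (real \<Rightarrow> real \<Rightarrow> real) \<Rightarrow> bool" where
  "h1_smooth d F \<longleftrightarrow> (\<exists>D :: nat \<Rightarrow> real \<Rightarrow> real \<Rightarrow> real.
      (\<forall>c. \<bar>c\<bar> < d \<longrightarrow> D 0 c = F c) \<and>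
      (\<forall>n c. \<bar>c\<bar> < d \<longrightarrow> H1 (D n c)) \<and>
      (\<forall>n. h1_has_deriv d (D n) (D (Suc n))))"

text \<open>|k| coth(a|k|), extended by continuity (value 1/a) at k = 0.\<close>
definition kcoth :: "real \<Rightarrow> real \<Rightarrow> real" where
  "kcoth a k = (if k = 0 then 1 / a else \<bar>k\<bar> * cosh (a * \<bar>k\<bar>) / sinh (a * \<bar>k\<bar>))"

definition symW :: "real \<Rightarrow> real \<Rightarrow> real \<Rightarrow> real \<Rightarrow> real \<Rightarrow> real" where
  "symW \<beta> \<gamma> \<mu> \<mu>\<^sub>2 k = 1 + \<beta> / \<gamma> * sqrt \<mu> * kcoth (sqrt \<mu>\<^sub>2) k"

definition symZ :: "real \<Rightarrow> real \<Rightarrow> real \<Rightarrow> real \<Rightarrow> real \<Rightarrow> real" where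
  "symZ \<beta> \<gamma> \<mu> \<mu>\<^sub>2 k = 1 / \<gamma> * (1 + (\<beta> - 1) / \<gamma> * sqrt \<mu> * kcoth (sqrt \<mu>\<^sub>2) k)"

text \<open>Symbol of the limiting operator (beta-1) sqrt mu / gamma^2 |D| + 1/gamma.\<close>
definition symL :: "real \<Rightarrow> real \<Rightarrow> real \<Rightarrow> real \<Rightarrow> real" where
  "symL \<beta> \<gamma> \<mu> k = (\<beta> - 1) * sqrt \<mu> / \<gamma>\<^sup>2 * \<bar>k\<bar> + 1 / \<gamma>"

end

theory Submission
  imports Defs "HOL-Probability.Probability" "HOL-Real_Asymp.Real_Asymp"
begin

text \<open>
  Put \<open>a = \<beta> sqrt \<mu> / \<gamma>\<close>, \<open>b = (\<beta> - 1) sqrt \<mu> / \<gamma>\<close> and let \<open>K\<close> be the multiplier with symbol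
  \<open>k coth (h k)\<close>, \<open>h = sqrt \<mu>\<^sub>2\<close>. Then \<open>w = b \<nu> / \<gamma> - c a \<xi>\<close> satisfies \<open>K w + w / b = f\<close> weakly, with
  \<open>f = \<epsilon> \<xi> \<nu> / \<gamma> + c (1 - a / b) \<xi>\<close>. Since \<open>\<nu>\<close> vanishes at infinity, \<open>w\<close> is comparable to \<open>\<nu>\<close> and
  \<open>\<bar>f\<bar> \<le> \<bar>w\<bar> / (2 b)\<close> far out, as soon as \<open>c\<close> is small.

  The partial fractions of \<open>coth\<close> turn \<open>K\<close> into \<open>1 / h\<close> plus a jump operator whose kernel is positive
  and exponentially decaying, so \<open>K\<close> obeys a maximum principle. Comparing a mollification of \<open>w\<close> with
  \<open>N exp (- \<eta> \<bar>x\<bar>)\<close> at a maximum of the difference gives the exponential decay of \<open>w\<close>.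
\<close>

section \<open>Smooth functions and mollifiers\<close>

text \<open>The symbols are 1 + a K and (1 + b K) / \<gamma>, so \<open>w\<close> is exactly the
  combination on which K acts in the first equation; \<open>w / b\<close> then absorbs the
  zeroth-order \<nu> term. The leftover multiple of c \<xi> does not decay faster than \<nu>: it is
  of size c^2 \<nu> at infinity, and this is what limits c.

  Finite h is essential. As h grows, the jump kernel tends to 1 / (pi y^2), the kernel of the
  multiplier with symbol |k|, which has no exponential moment; accordingly \<eta> depends on h. The
  margin that pays for the exponential moment is 1 / h, the value of the symbol at k = 0.

  The obstacle is regularity: \<open>w\<close> is only known to be continuous and to vanish at
  infinity, so K w has no pointwise meaning, and the equation is available only with K moved onto a
  test function. The kernel representation is therefore proved for test functions, where Fourier
  inversion and Fubini apply, and reaches the mollified \<open>w\<close> by taking the reflected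
  mollifier as the test function. The right-hand side gets mollified too, and uniform continuity
  makes both errors small uniformly in x.\<close>

definition smooth_fun :: "(real \<Rightarrow> real) \<Rightarrow> bool" where
  "smooth_fun f \<longleftrightarrow> (\<forall>n x. ((deriv ^^ n) f) differentiable (at x))"

text \<open>The invariant travels along the iterated derivatives, so a smoothness proof only needs a
  class of functions stable under one differentiation; no formula for the n-th derivative is ever
  computed.\<close>

lemma smooth_fun_coinduct:
  assumes "P f"
    and step: "\<And>f. P f \<Longrightarrow> \<exists>g. (\<forall>x. (f has_real_derivative g x) (at x)) \<and> P g"
  shows "smooth_fun f"
proof -
  have "P ((deriv ^^ n) f)" for n
  proof (induction n)
    case (Suc n)
    obtain g where g: "\<forall>x. ((deriv ^^ n) f has_real_derivative g x) (at x)" "P g"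
      using step[OF Suc] by blast
    then have "deriv ((deriv ^^ n) f) = g"
      by (auto intro!: DERIV_imp_deriv)
    with g show ?case by simp
  qed (use assms in simp)
  then show ?thesis
    unfolding smooth_fun_def using step real_differentiable_def by blast
qed

lemma smooth_fun_deriv:
  assumes "smooth_fun f"
  shows "(f has_real_derivative deriv f x) (at x)" "smooth_fun (deriv f)"
proof -
  have "f differentiable (at x)"
    using assms[unfolded smooth_fun_def, rule_format, of 0] by simp
  then show "(f has_real_derivative deriv f x) (at x)"
    using DERIV_deriv_iff_real_differentiable by blast
  show "smooth_fun (deriv f)"
    unfolding smooth_fun_def
  proof (intro allI)
    fix n x
    show "(deriv ^^ n) (deriv f) differentiable (at x)"
      using assms[unfolded smooth_fun_def, rule_format, of "Suc n" x] by (simp add: funpow_swap1)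
  qed
qed

text \<open>Adjoining \<open>f\<close> to the smooth functions gives a class stable under
  differentiation. This serves the smoothed indicator in \<open>H1_increment_bound\<close>, which is
  known only through its derivative.\<close>

lemma smooth_fun_antideriv:
  assumes "\<And>x. (f has_real_derivative g x) (at x)" "smooth_fun g"
  shows "smooth_fun f"
proof (rule smooth_fun_coinduct[where P="\<lambda>u. u = f \<or> smooth_fun u"])
  show "\<exists>v. (\<forall>x. (u has_real_derivative v x) (at x)) \<and> (v = f \<or> smooth_fun v)"
    if "u = f \<or> smooth_fun u" for u
    using that assms smooth_fun_deriv by metis
qed simp

lemma smooth_fun_affine:
  assumes "smooth_fun f"
  shows "smooth_fun (\<lambda>x. s * f (c * x + t))"
proof (rule smooth_fun_coinduct[where P="\<lambda>u. \<exists>g s. smooth_fun g \<and> u = (\<lambda>x. s * g (c * x + t))"])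
  fix u
  assume "\<exists>g s. smooth_fun g \<and> u = (\<lambda>x. s * g (c * x + t))"
  then obtain g s where g: "smooth_fun g" and u: "u = (\<lambda>x. s * g (c * x + t))" by blast
  have "((\<lambda>x. s * g (c * x + t)) has_real_derivative (s * c) * deriv g (c * x + t)) (at x)" for x
    by (rule derivative_eq_intros DERIV_chain2[OF smooth_fun_deriv(1)[OF g]] refl)+ simp
  then show "\<exists>v. (\<forall>x. (u has_real_derivative v x) (at x)) \<and> (\<exists>g s. smooth_fun g \<and> v = (\<lambda>x. s * g (c * x + t)))"
    unfolding u using smooth_fun_deriv(2)[OF g]
    by (intro exI[of _ "\<lambda>x. (s * c) * deriv g (c * x + t)"]) blast
qed (use assms in blast)

lemma smooth_fun_add:
  assumes "smooth_fun f" "smooth_fun g"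
  shows "smooth_fun (\<lambda>x. f x + g x)"
proof (rule smooth_fun_coinduct[where P="\<lambda>u. \<exists>f g. smooth_fun f \<and> smooth_fun g \<and> u = (\<lambda>x. f x + g x)"])
  fix u
  assume "\<exists>f g. smooth_fun f \<and> smooth_fun g \<and> u = (\<lambda>x. f x + g x)"
  then obtain f g where fg: "smooth_fun f" "smooth_fun g" and u: "u = (\<lambda>x. f x + g x)" by blast
  have "((\<lambda>x. f x + g x) has_real_derivative deriv f x + deriv g x) (at x)" for x
    using smooth_fun_deriv(1)[OF fg(1)] smooth_fun_deriv(1)[OF fg(2)] by (auto intro!: derivative_eq_intros)
  then show "\<exists>v. (\<forall>x. (u has_real_derivative v x) (at x)) \<and> (\<exists>f g. smooth_fun f \<and> smooth_fun g \<and> v = (\<lambda>x. f x + g x))"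
    unfolding u using smooth_fun_deriv(2)[OF fg(1)] smooth_fun_deriv(2)[OF fg(2)]
    by (intro exI[of _ "\<lambda>x. deriv f x + deriv g x"]) blast
qed (use assms in blast)

text \<open>The classical flat function is the case \<open>p = 1\<close>. The polynomial in 1 / x is
  what differentiation produces, so carrying it along keeps the family closed under
  derivatives.\<close>

definition flat_fun :: "real poly \<Rightarrow> real \<Rightarrow> real" where
  "flat_fun p x = (if 0 < x then poly p (1 / x) * exp (- (1 / x)) else 0)"

lemma poly_times_exp_neg_tendsto_0: "((\<lambda>t::real. poly p t * exp (- t)) \<longlongrightarrow> 0) at_top"
proof -
  have "((\<lambda>t. \<Sum>i\<le>degree p. coeff p i * (t ^ i / exp t)) \<longlongrightarrow> (\<Sum>i\<le>degree p. coeff p i * 0)) at_top"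
    by (intro tendsto_intros tendsto_power_div_exp_0)
  then show ?thesis
    by (simp add: poly_altdef sum_distrib_right exp_minus divide_inverse mult.assoc)
qed

lemma flat_fun_tendsto_0: "(flat_fun p \<longlongrightarrow> 0) (at 0)"
proof -
  have "((\<lambda>x. poly p (1 / x) * exp (- (1 / x))) \<longlongrightarrow> 0) (at_right (0::real))"
    using filterlim_compose[OF poly_times_exp_neg_tendsto_0 filterlim_inverse_at_top_right]
    by (simp add: inverse_eq_divide)
  then have "(flat_fun p \<longlongrightarrow> 0) (at_right 0)"
    by (rule Lim_transform_eventually) (auto simp: flat_fun_def eventually_at_filter)
  moreover have "(flat_fun p \<longlongrightarrow> 0) (at_left 0)"
    by (rule Lim_transform_eventually[OF tendsto_const]) (auto simp: flat_fun_def eventually_at_filter)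
  ultimately show ?thesis
    by (simp add: filterlim_split_at)
qed

text \<open>With t = 1 / x one has d/dx = - t^2 d/dt, which sends p(t) exp(- t) to t^2 (p - p')(t)
  exp(- t).\<close>

lemma flat_fun_has_derivative:
  "(flat_fun p has_real_derivative flat_fun (monom 1 2 * (p - pderiv p)) x) (at x)"
proof (cases x "0::real" rule: linorder_cases)
  case less
  have "((\<lambda>x. 0) has_real_derivative 0) (at x)" by simp
  then have "(flat_fun p has_real_derivative 0) (at x)"
    by (rule has_field_derivative_transform_within_open[where S="{..<0}"]) (use less in \<open>auto simp: flat_fun_def\<close>)
  with less show ?thesis by (simp add: flat_fun_def)
next
  case equal
  \<comment> \<open>Dividing by h multiplies the polynomial by t = 1 / h, so the difference quotient
    at 0 is again a flat function, namely that of \<open>pCons 0 p\<close>.\<close>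
  have "((\<lambda>h. (flat_fun p (0 + h) - flat_fun p 0) / h) \<longlongrightarrow> 0) (at 0)"
    by (rule Lim_transform_eventually[OF flat_fun_tendsto_0[of "pCons 0 p"]])
       (auto simp: flat_fun_def eventually_at_filter)
  with equal show ?thesis by (simp add: DERIV_def flat_fun_def)
next
  case greater
  have "((\<lambda>x. poly p (1 / x) * exp (- (1 / x))) has_real_derivative
          poly (monom 1 2 * (p - pderiv p)) (1 / x) * exp (- (1 / x))) (at x)"
    using greater
    by (auto intro!: derivative_eq_intros DERIV_chain2[OF poly_DERIV] simp: poly_monom field_simps power2_eq_square)
  then have "(flat_fun p has_real_derivative poly (monom 1 2 * (p - pderiv p)) (1 / x) * exp (- (1 / x))) (at x)"
    by (rule has_field_derivative_transform_within_open[where S="{0<..}"]) (use greater in \<open>auto simp: flat_fun_def\<close>)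
  with greater show ?thesis by (simp add: flat_fun_def)
qed

text \<open>Closing the products under addition makes the class closed under differentiation.\<close>

inductive flat_prod :: "(real \<Rightarrow> real) \<Rightarrow> bool" where
  "flat_prod (\<lambda>x. flat_fun p (1 + x) * flat_fun q (1 - x))"
| "flat_prod f \<Longrightarrow> flat_prod g \<Longrightarrow> flat_prod (\<lambda>x. f x + g x)"

lemma flat_prod_smooth:
  assumes "flat_prod f" shows "smooth_fun f"
  using assms
proof (rule smooth_fun_coinduct)
  fix f
  assume "flat_prod f"
  then show "\<exists>g. (\<forall>x. (f has_real_derivative g x) (at x)) \<and> flat_prod g"
  proof induction
    case (1 p q)
    let ?D = "\<lambda>p. monom 1 2 * (p - pderiv p) :: real poly"
    have "((\<lambda>x. flat_fun p (1 + x) * flat_fun q (1 - x)) has_real_derivative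
            flat_fun (?D p) (1 + x) * flat_fun q (1 - x) + flat_fun p (1 + x) * flat_fun (- ?D q) (1 - x)) (at x)" for x
      by (rule derivative_eq_intros DERIV_chain2[OF flat_fun_has_derivative] refl)+
         (auto simp: flat_fun_def)
    then show ?case
      by (intro exI[of _ "\<lambda>x. flat_fun (?D p) (1 + x) * flat_fun q (1 - x) + flat_fun p (1 + x) * flat_fun (- ?D q) (1 - x)"])
         (auto intro: flat_prod.intros)
  next
    case (2 f g)
    then obtain f' g' where *: "\<And>x. (f has_real_derivative f' x) (at x)" "flat_prod f'"
      "\<And>x. (g has_real_derivative g' x) (at x)" "flat_prod g'" by blast
    then have "((\<lambda>x. f x + g x) has_real_derivative f' x + g' x) (at x)" for x
      by (auto intro!: derivative_eq_intros)
    with * show ?case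
      by (intro exI[of _ "\<lambda>x. f' x + g' x"]) (auto intro: flat_prod.intros)
  qed
qed

section \<open>Test functions: stability, integrability, bounds\<close>

lemma test_fun_iff: "test_fun \<phi> \<longleftrightarrow> smooth_fun \<phi> \<and> (\<exists>R. \<forall>x. R < \<bar>x\<bar> \<longrightarrow> \<phi> x = 0)"
  by (simp add: test_fun_def smooth_fun_def)

lemma test_fun_support:
  assumes "test_fun \<phi>"
  obtains R where "R > 0" "\<And>x. R < \<bar>x\<bar> \<Longrightarrow> \<phi> x = 0"
proof -
  obtain R where R: "\<forall>x. R < \<bar>x\<bar> \<longrightarrow> \<phi> x = 0"
    using assms unfolding test_fun_def by blast
  then show thesis by (intro that[of "max R 1"]) auto
qed

lemma test_fun_DERIV: "test_fun \<phi> \<Longrightarrow> (\<phi> has_real_derivative deriv \<phi> x) (at x)"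
  by (simp add: test_fun_iff smooth_fun_deriv)

lemma test_fun_deriv:
  assumes "test_fun \<phi>" shows "test_fun (deriv \<phi>)"
proof -
  obtain R where R: "\<And>x. R < \<bar>x\<bar> \<Longrightarrow> \<phi> x = 0" using test_fun_support[OF assms] by metis
  have "deriv \<phi> x = 0" if "R < \<bar>x\<bar>" for x
  proof -
    have "((\<lambda>x. 0) has_real_derivative 0) (at x)" by simp
    then have "(\<phi> has_real_derivative 0) (at x)"
      by (rule has_field_derivative_transform_within_open[where S="{x. R < \<bar>x\<bar>}"])
         (use that R in \<open>auto intro!: open_Collect_less continuous_intros\<close>)
    then show ?thesis by (rule DERIV_imp_deriv)
  qed
  with assms show ?thesis by (auto simp: test_fun_iff smooth_fun_deriv)
qed

lemma test_fun_continuous: "test_fun \<phi> \<Longrightarrow> continuous_on A \<phi>"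
  by (meson DERIV_isCont continuous_at_imp_continuous_on test_fun_DERIV)

lemma test_fun_measurable: "test_fun \<phi> \<Longrightarrow> \<phi> \<in> borel_measurable borel"
  by (intro borel_measurable_continuous_onI test_fun_continuous)

lemma continuous_compact_support_integrable:
  fixes \<phi> :: "real \<Rightarrow> real"
  assumes "continuous_on UNIV \<phi>" "\<And>x. R < \<bar>x\<bar> \<Longrightarrow> \<phi> x = 0"
  shows "integrable lborel \<phi>"
proof -
  have "set_integrable lborel {-R..R} \<phi>"
    by (intro borel_integrable_atLeastAtMost' continuous_on_subset[OF assms(1)]) auto
  moreover have "(\<lambda>x. indicator {-R..R} x *\<^sub>R \<phi> x) = \<phi>"
    using assms(2) by (fastforce split: split_indicator)
  ultimately show ?thesis by (simp add: set_integrable_def)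
qed

lemma test_fun_integrable: "test_fun \<phi> \<Longrightarrow> integrable lborel \<phi>"
  by (metis test_fun_support continuous_compact_support_integrable test_fun_continuous)

lemma test_fun_bounded:
  assumes "test_fun \<phi>"
  obtains B where "B > 0" "\<And>x. \<bar>\<phi> x\<bar> \<le> B"
proof -
  obtain R where R: "\<And>x. R < \<bar>x\<bar> \<Longrightarrow> \<phi> x = 0" using test_fun_support[OF assms] by metis
  have "bounded (\<phi> ` {-R..R})"
    by (intro compact_imp_bounded compact_continuous_image test_fun_continuous assms) auto
  then obtain B where B: "B > 0" "\<And>x. x \<in> {-R..R} \<Longrightarrow> \<bar>\<phi> x\<bar> \<le> B"
    unfolding bounded_pos by auto
  have "\<bar>\<phi> x\<bar> \<le> B" for x
    using B(1) B(2)[of x] R[of x] by (cases "\<bar>x\<bar> \<le> R") (auto simp: abs_le_iff)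
  with B show thesis using that by blast
qed

lemma test_fun_affine:
  assumes "test_fun \<phi>" "c \<noteq> 0"
  shows "test_fun (\<lambda>x. s * \<phi> (c * x + t))"
proof -
  obtain R where R: "\<And>x. R < \<bar>x\<bar> \<Longrightarrow> \<phi> x = 0" using test_fun_support[OF assms(1)] by metis
  have "\<phi> (c * x + t) = 0" if "(\<bar>R\<bar> + \<bar>t\<bar>) / \<bar>c\<bar> < \<bar>x\<bar>" for x
  proof (rule R)
    have "\<bar>R\<bar> + \<bar>t\<bar> < \<bar>c * x\<bar>"
      using that assms(2) by (simp add: field_simps abs_mult)
    then show "R < \<bar>c * x + t\<bar>" by linarith
  qed
  then have "\<exists>R. \<forall>x. R < \<bar>x\<bar> \<longrightarrow> s * \<phi> (c * x + t) = 0" by auto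
  with assms smooth_fun_affine show ?thesis by (simp add: test_fun_iff)
qed

text \<open>The bump is a product of two flat functions, one dying at -1 and the other at 1; it is
  then rescaled to width r and mass 1.\<close>

lemma mollifier_exists:
  fixes r :: real
  assumes "r > 0"
  obtains \<rho> where "test_fun \<rho>" "\<And>x. 0 \<le> \<rho> x" "\<And>x. r \<le> \<bar>x\<bar> \<Longrightarrow> \<rho> x = 0"
    "(LINT x|lborel. \<rho> x) = 1"
proof -
  define B where "B = (\<lambda>x. flat_fun 1 (1 + x) * flat_fun 1 (1 - x))"
  have B0: "B x = 0" if "1 \<le> \<bar>x\<bar>" for x
    using that by (auto simp: B_def flat_fun_def)
  have "flat_prod B" unfolding B_def by (rule flat_prod.intros)
  then have tB: "test_fun B"
    using B0 by (auto simp: test_fun_iff flat_prod_smooth intro!: exI[of _ 1])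
  have Bnn: "0 \<le> B x" for x by (simp add: B_def flat_fun_def)
  \<comment> \<open>A vanishing integral would make the open set where B is nonzero negligible,
    hence empty, although it contains 0.\<close>
  have "(LINT x|lborel. B x) \<noteq> 0"
  proof
    assume "(LINT x|lborel. B x) = 0"
    then have "AE x in lborel. B x = 0"
      using integral_nonneg_eq_0_iff_AE[OF test_fun_integrable[OF tB]] Bnn by simp
    moreover have o: "open {x. B x \<noteq> 0}"
      by (intro open_Collect_neq test_fun_continuous[OF tB] continuous_on_const)
    ultimately have "{x. B x \<noteq> 0} \<in> null_sets lborel"
      by (simp add: AE_iff_null_sets borel_open)
    then have "negligible {x. B x \<noteq> 0}"
      by (simp add: negligible_iff_null_sets null_sets_completionI)
    then have "B 0 = 0"
      using open_not_negligible[OF o] by blast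
    then show False by (simp add: B_def flat_fun_def)
  qed
  then have pos: "(LINT x|lborel. B x) > 0"
    using Bochner_Integration.integral_nonneg[of lborel B] Bnn by (simp add: less_le)
  \<comment> \<open>Stretching by r multiplies the mass of B by r.\<close>
  define s where "s = 1 / (r * (LINT x|lborel. B x))"
  define \<rho> where "\<rho> = (\<lambda>x. s * B ((1 / r) * x + 0))"
  show thesis
  proof
    show "test_fun \<rho>" unfolding \<rho>_def using tB assms by (intro test_fun_affine) auto
    show "0 \<le> \<rho> x" for x using Bnn pos assms by (simp add: \<rho>_def s_def)
    show "\<rho> x = 0" if "r \<le> \<bar>x\<bar>" for x
      using B0[of "x / r"] that assms by (simp add: \<rho>_def)
    have "(LINT x|lborel. B x) = \<bar>1 / r\<bar> *\<^sub>R (LINT x|lborel. B (0 + 1 / r * x))"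
      using assms by (intro lborel_integral_real_affine) auto
    then have e: "(LINT x|lborel. B (1 / r * x + 0)) = r * (LINT x|lborel. B x)"
      using assms by (simp add: field_simps)
    have "(LINT x|lborel. \<rho> x) = s * (LINT x|lborel. B (1 / r * x + 0))"
      unfolding \<rho>_def by (rule integral_mult_right_zero)
    also have "\<dots> = 1"
      unfolding e s_def using assms pos by simp
    finally show "(LINT x|lborel. \<rho> x) = 1" .
  qed
qed

section \<open>The kernel of the multiplier\<close>

text \<open>The logarithmic derivative of the reflection formula gives Digamma(1 - z) - Digamma(z) =
  pi cot(pi z), and the series of Digamma turns the left side into partial fractions. At z = i t the
  cotangent becomes the hyperbolic one.\<close>

lemma coth_partial_fractions:
  fixes t :: real
  assumes "t > 0"
  shows "(\<lambda>n. 2 * t / ((real n + 1)\<^sup>2 + t\<^sup>2)) sums (pi * cosh (pi * t) / sinh (pi * t) - 1 / t)"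
proof -
  define z where "z = \<i> * complex_of_real t"
  have nz: "z \<noteq> 0" "1 - z \<noteq> 0" "1 + z \<noteq> 0"
    using assms by (auto simp: z_def complex_eq_iff)
  have ni: "z \<notin> \<int>\<^sub>\<le>\<^sub>0" "1 - z \<notin> \<int>\<^sub>\<le>\<^sub>0"
    using assms by (auto simp: z_def complex_eq_iff elim!: nonpos_Ints_cases)
  have "((\<lambda>z. rGamma z * rGamma (1 - z)) has_field_derivative
          rGamma z * rGamma (1 - z) * (Digamma (1 - z) - Digamma z)) (at z)"
    by (rule derivative_eq_intros DERIV_chain2[of rGamma] has_field_derivative_rGamma_no_nonpos_int ni refl)+
       (simp add: algebra_simps)
  moreover have "((\<lambda>z. rGamma z * rGamma (1 - z)) has_field_derivative cos (of_real pi * z)) (at z)"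
    unfolding rGamma_reflection_complex by (auto intro!: derivative_eq_intros)
  ultimately have d: "sin (of_real pi * z) / of_real pi * (Digamma (1 - z) - Digamma z) = cos (of_real pi * z)"
    unfolding rGamma_reflection_complex using DERIV_unique by blast
  have of_real: "sinh (complex_of_real x) = of_real (sinh x)" "cosh (complex_of_real x) = of_real (cosh x)" for x
    by (simp_all add: sinh_def cosh_def scaleR_conv_of_real flip: exp_of_real)
  have piz: "of_real pi * z = \<i> * complex_of_real (pi * t)" by (simp add: z_def)
  have sn: "sin (of_real pi * z) = \<i> * complex_of_real (sinh (pi * t))"
    unfolding piz of_real(1)[symmetric] sinh_conv_sin by simp
  have cs: "cos (of_real pi * z) = complex_of_real (cosh (pi * t))"
    unfolding piz of_real(2)[symmetric] cosh_conv_cos by simp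
  have sh: "sinh (pi * t) \<noteq> 0" using assms by simp
  have dd: "Digamma (1 - z) - Digamma z = - \<i> * of_real (pi * cosh (pi * t) / sinh (pi * t))"
  proof -
    let ?X = "Digamma (1 - z) - Digamma z"
    have "?X = (\<i> * of_real (sinh (pi * t)) / of_real pi * ?X) * (- \<i> * of_real pi / of_real (sinh (pi * t)))"
    proof -
      have *: "(\<i> * S / p * X) * (- \<i> * p / S) = X" if "S \<noteq> 0" "p \<noteq> 0" for S p X :: complex
        using that by (simp add: field_simps)
      show ?thesis by (rule *[symmetric]) (use sh in simp_all)
    qed
    also have "\<dots> = - \<i> * of_real (pi * cosh (pi * t) / sinh (pi * t))"
      using d unfolding sn cs by simp
    finally show ?thesis .
  qed
  have "(\<lambda>n. (inverse (of_nat (Suc n)) - inverse (1 - z + of_nat n)) - (inverse (of_nat (Suc n)) - inverse (1 + z + of_nat n)))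
          sums ((Digamma (1 - z) + euler_mascheroni) - (Digamma (1 + z) + euler_mascheroni))"
    using summable_sums[OF summable_Digamma[OF nz(2)]] summable_sums[OF summable_Digamma[OF nz(3)]]
    by (intro sums_diff) (simp_all add: Digamma_def)
  \<comment> \<open>Shifting z to 1 + z aligns the two series, so that their n-th terms have the
    conjugate denominators n + 1 + z and n + 1 - z; the shift is the source of the term 1 /
    t.\<close>
  moreover have "Digamma (1 + z) = Digamma z + 1 / z"
    using Digamma_plus1[OF nz(1)] by (simp add: add.commute)
  ultimately have "(\<lambda>n. \<i> * (inverse (1 + z + of_nat n) - inverse (1 - z + of_nat n))) sums
      (\<i> * (- \<i> * of_real (pi * cosh (pi * t) / sinh (pi * t)) - 1 / z))"
    unfolding dd[symmetric] by (intro sums_mult) (simp add: algebra_simps)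
  moreover have "\<i> * (inverse (1 + z + of_nat n) - inverse (1 - z + of_nat n)) =
      complex_of_real (2 * t / ((real n + 1)\<^sup>2 + t\<^sup>2))" for n
  proof -
    have "1 + z + of_nat n \<noteq> 0" "1 - z + of_nat n \<noteq> 0"
      using assms by (auto simp: z_def complex_eq_iff)
    then have "\<i> * (inverse (1 + z + of_nat n) - inverse (1 - z + of_nat n)) =
        \<i> * (- 2 * z) / ((1 + z + of_nat n) * (1 - z + of_nat n))"
      by (simp add: field_simps)
    also have "(1 + z + of_nat n) * (1 - z + of_nat n) = complex_of_real ((real n + 1)\<^sup>2 + t\<^sup>2)"
      by (simp add: z_def algebra_simps power2_eq_square)
    also have "\<i> * (- 2 * z) = complex_of_real (2 * t)" by (simp add: z_def)
    finally show ?thesis by simp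
  qed
  moreover have "\<i> * (- \<i> * of_real (pi * cosh (pi * t) / sinh (pi * t)) - 1 / z) =
      complex_of_real (pi * cosh (pi * t) / sinh (pi * t) - 1 / t)"
    using assms by (simp add: z_def field_simps)
  ultimately have "(\<lambda>n. complex_of_real (2 * t / ((real n + 1)\<^sup>2 + t\<^sup>2))) sums
      complex_of_real (pi * cosh (pi * t) / sinh (pi * t) - 1 / t)"
    by (simp only:)
  then show ?thesis by (simp only: sums_of_real_iff)
qed

section \<open>Integrals of even exponentials, and the jump kernel as their sum\<close>

lemma has_bochner_integral_even_FTC:
  fixes f F :: "real \<Rightarrow> real"
  assumes [measurable]: "f \<in> borel_measurable borel"
    and "\<And>x. f (- x) = f x" "\<And>x. 0 \<le> f x"
    and "\<And>x. 0 \<le> x \<Longrightarrow> (F has_real_derivative f x) (at x)" "(F \<longlongrightarrow> T) at_top"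
  shows "has_bochner_integral lborel f (2 * (T - F 0))"
proof -
  have "(\<integral>\<^sup>+x. ennreal (f x) * indicator {0..} x \<partial>lborel) = ennreal (T - F 0)"
    by (rule nn_integral_FTC_atLeast) (use assms in auto)
  moreover have "F 0 \<le> T"
  proof (rule tendsto_lowerbound[OF assms(5)])
    show "\<forall>\<^sub>F x in at_top. F 0 \<le> F x"
      using eventually_ge_at_top[of 0]
    proof eventually_elim
      case (elim x)
      then show ?case
        using assms(3,4) by (intro DERIV_nonneg_imp_nondecreasing[of 0 x F]) auto
    qed
  qed simp
  ultimately have "has_bochner_integral lborel (\<lambda>x. indicator {0..} x *\<^sub>R f x) (T - F 0)"
    by (intro has_bochner_integral_nn_integral)
       (use assms in \<open>auto simp: ennreal_mult' ennreal_indicator mult.commute\<close>)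
  from has_bochner_integral_even_function[OF this assms(2)] show ?thesis by simp
qed

lemma has_bochner_integral_exp_abs:
  fixes b :: real
  assumes "b > 0"
  shows "has_bochner_integral lborel (\<lambda>y. exp (- b * \<bar>y\<bar>)) (2 / b)"
proof -
  have "has_bochner_integral lborel (\<lambda>y. exp (- b * \<bar>y\<bar>)) (2 * (0 - (- exp (- b * 0) / b)))"
  proof (rule has_bochner_integral_even_FTC[where F="\<lambda>y. - exp (- b * y) / b"])
    show "((\<lambda>y. - exp (- b * y) / b) \<longlongrightarrow> 0) at_top"
      using assms by real_asymp
  qed (use assms in \<open>auto intro!: derivative_eq_intros simp: field_simps\<close>)
  then show ?thesis by simp
qed

lemmas integrable_exp_abs = has_bochner_integral_exp_abs[THEN integrable.intros]
lemmas integral_exp_abs = has_bochner_integral_exp_abs[THEN has_bochner_integral_integral_eq]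

text \<open>Each partial fraction of coth is the symbol of a jump operator with a two-sided
  exponential kernel. Summing over b = pi (n + 1) / h will produce the kernel of K.\<close>

lemma has_bochner_integral_exp_abs_cos:
  fixes b k :: real
  assumes "b > 0"
  shows "has_bochner_integral lborel (\<lambda>y. b * exp (- b * \<bar>y\<bar>) * (1 - cos (k * y))) (2 * k\<^sup>2 / (b\<^sup>2 + k\<^sup>2))"
proof -
  \<comment> \<open>The second term is b times the real part of exp((- b + i k) y) / (- b + i k), an
    antiderivative of exp(- b y) cos(k y) on the half-line.\<close>
  define F where "F = (\<lambda>y. - exp (- b * y) - b / (b\<^sup>2 + k\<^sup>2) * (exp (- b * y) * (k * sin (k * y) - b * cos (k * y))))"
  have nz: "b\<^sup>2 + k\<^sup>2 \<noteq> 0" using assms by (simp add: sum_power2_eq_zero_iff)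
  have "has_bochner_integral lborel (\<lambda>y. b * exp (- b * \<bar>y\<bar>) * (1 - cos (k * y))) (2 * (0 - F 0))"
  proof (rule has_bochner_integral_even_FTC)
    show "(F has_real_derivative b * exp (- b * \<bar>x\<bar>) * (1 - cos (k * x))) (at x)" if "0 \<le> x" for x
    proof -
      have "(F has_real_derivative b * exp (- b * x) - b / (b\<^sup>2 + k\<^sup>2) * ((b\<^sup>2 + k\<^sup>2) * (exp (- b * x) * cos (k * x)))) (at x)"
        unfolding F_def
      proof (intro DERIV_diff DERIV_cmult)
        show "((\<lambda>y. - exp (- b * y)) has_real_derivative b * exp (- b * x)) (at x)"
          by (auto intro!: derivative_eq_intros)
        show "((\<lambda>y. exp (- b * y) * (k * sin (k * y) - b * cos (k * y))) has_real_derivative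
            (b\<^sup>2 + k\<^sup>2) * (exp (- b * x) * cos (k * x))) (at x)"
          by (auto intro!: derivative_eq_intros simp: algebra_simps power2_eq_square)
      qed
      moreover have "b * exp (- b * x) - b / (b\<^sup>2 + k\<^sup>2) * ((b\<^sup>2 + k\<^sup>2) * (exp (- b * x) * cos (k * x)))
          = b * exp (- b * \<bar>x\<bar>) * (1 - cos (k * x))"
        using nz that by (simp add: right_diff_distrib flip: mult.assoc)
      ultimately show ?thesis by simp
    qed
    have "((\<lambda>y. exp (- b * y)) \<longlongrightarrow> 0) at_top" using assms by real_asymp
    moreover have "((\<lambda>y. exp (- b * y) * (k * sin (k * y) - b * cos (k * y))) \<longlongrightarrow> 0) at_top"
    proof (rule tendsto_0_le[OF calculation, where K="\<bar>k\<bar> + \<bar>b\<bar>"], intro always_eventually allI)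
      fix y
      have "\<bar>k * sin (k * y) - b * cos (k * y)\<bar> \<le> \<bar>k\<bar> * 1 + \<bar>b\<bar> * 1"
        by (rule order_trans[OF abs_triangle_ineq4]) (unfold abs_mult, intro add_mono mult_left_mono abs_sin_le_one abs_cos_le_one abs_ge_zero)
      then show "norm (exp (- b * y) * (k * sin (k * y) - b * cos (k * y))) \<le> norm (exp (- b * y)) * (\<bar>k\<bar> + \<bar>b\<bar>)"
        by (simp add: abs_mult)
    qed
    ultimately have "((\<lambda>y. - exp (- b * y) - b / (b\<^sup>2 + k\<^sup>2) * (exp (- b * y) * (k * sin (k * y) - b * cos (k * y))))
        \<longlongrightarrow> - 0 - b / (b\<^sup>2 + k\<^sup>2) * 0) at_top"
      by (intro tendsto_intros)
    then show "(F \<longlongrightarrow> 0) at_top" by (simp add: F_def)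
  qed (use assms in auto)
  moreover have "2 * (0 - F 0) = 2 * k\<^sup>2 / (b\<^sup>2 + k\<^sup>2)"
    using nz by (simp add: F_def field_simps power2_eq_square)
  ultimately show ?thesis by simp
qed

text \<open>The jump density of K - 1 / h, behaving like 1 / (pi y^2) near 0 and like exp(- pi |y| /
  h) far out. Division by zero makes it 0 at y = 0.\<close>

definition coth_kernel :: "real \<Rightarrow> real \<Rightarrow> real" where
  "coth_kernel h y = pi / (4 * h\<^sup>2 * (sinh (pi * y / (2 * h)))\<^sup>2)"

lemma coth_kernel_nonneg: "0 \<le> coth_kernel h y"
  by (simp add: coth_kernel_def)

lemma coth_kernel_measurable [measurable]: "coth_kernel h \<in> borel_measurable borel"
proof -
  have "(\<lambda>y. sinh (pi * y / (2 * h))) \<in> borel_measurable borel"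
    unfolding times_divide_eq_left[symmetric]
    by (intro borel_measurable_continuous_onI continuous_intros)
  then show ?thesis unfolding coth_kernel_def[abs_def] by measurable
qed

text \<open>With s = pi |y| / h this is the differentiated geometric series in exp(- s), closed by
  exp(- s) / (1 - exp(- s))^2 = 1 / (4 sinh(s / 2)^2).\<close>

lemma coth_kernel_sums:
  assumes "h > 0" "y \<noteq> 0"
  shows "(\<lambda>n. 1 / h * (pi / h * (real n + 1) * exp (- (pi / h * (real n + 1)) * \<bar>y\<bar>))) sums coth_kernel h y"
proof -
  define s where "s = pi / h * \<bar>y\<bar>"
  have s: "s > 0" using assms by (simp add: s_def)
  have "norm (exp (- s)) < 1" using s by simp
  from geometric_deriv_sums[OF this]
  have "(\<lambda>n. (pi / h\<^sup>2 * exp (- s)) * (of_nat (Suc n) * exp (- s) ^ n)) sums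
          ((pi / h\<^sup>2 * exp (- s)) * (1 / (1 - exp (- s))\<^sup>2))"
    by (rule sums_mult)
  moreover have "(pi / h\<^sup>2 * exp (- s)) * (of_nat (Suc n) * exp (- s) ^ n) =
      1 / h * (pi / h * (real n + 1) * exp (- (pi / h * (real n + 1)) * \<bar>y\<bar>))" for n
  proof -
    have "exp (- (pi / h * (real n + 1)) * \<bar>y\<bar>) = exp (- s) * exp (- s) ^ n"
      by (simp add: s_def flip: exp_of_nat_mult exp_add) (simp add: algebra_simps add_divide_distrib)
    then show ?thesis by (simp add: power2_eq_square algebra_simps)
  qed
  moreover have "(pi / h\<^sup>2 * exp (- s)) * (1 / (1 - exp (- s))\<^sup>2) = coth_kernel h y"
  proof -
    have "pi * y / (2 * h) = s / 2 \<or> pi * y / (2 * h) = - (s / 2)"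
      by (auto simp: s_def abs_if)
    then have "(sinh (pi * y / (2 * h)))\<^sup>2 = (sinh (s / 2))\<^sup>2"
      by (elim disjE) (simp_all only: sinh_minus power2_minus)
    also have "\<dots> = (1 - exp (- s))\<^sup>2 / (4 * exp (- s))"
    proof -
      have "exp (- s) = exp (- (s / 2)) * exp (- (s / 2))" by (simp flip: exp_add)
      moreover have "exp (s / 2) * exp (- (s / 2)) = 1" by (simp flip: exp_add)
      moreover have "sinh (s / 2) * 2 = exp (s / 2) - exp (- (s / 2))" by (simp add: sinh_def)
      ultimately have "(sinh (s / 2) * 2 * exp (- (s / 2))) = 1 - exp (- s)"
        by (metis left_diff_distrib)
      then have "(sinh (s / 2) * 2 * exp (- (s / 2)))\<^sup>2 = (1 - exp (- s))\<^sup>2" by simp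
      then have "(sinh (s / 2))\<^sup>2 * (4 * exp (- s)) = (1 - exp (- s))\<^sup>2"
        by (simp add: power_mult_distrib flip: exp_double)
      then show ?thesis by (simp add: field_simps)
    qed
    finally show ?thesis by (simp add: coth_kernel_def)
  qed
  ultimately show ?thesis by simp
qed

text \<open>Kernel and symbol are both series over the same b, matched term by term by the cosine
  integrals above. All terms are nonnegative, so convergence of the integrals already justifies
  exchanging sum and integral.\<close>

lemma has_bochner_integral_coth_kernel_cos:
  assumes "h > 0"
  shows "has_bochner_integral lborel (\<lambda>y. (1 - cos (k * y)) * coth_kernel h y) (kcoth h k - 1 / h)"
proof (cases "k = 0")
  case True
  then show ?thesis by (simp add: kcoth_def has_bochner_integral_iff)
next
  case False
  define b where "b = (\<lambda>n. pi / h * (real n + 1))"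
  define g where "g = (\<lambda>n y. 1 / h * (b n * exp (- b n * \<bar>y\<bar>) * (1 - cos (k * y))))"
  have bpos: "b n > 0" for n using assms by (simp add: b_def add_pos_nonneg)
  have gint: "has_bochner_integral lborel (g n) (1 / h * (2 * k\<^sup>2 / ((b n)\<^sup>2 + k\<^sup>2)))" for n
    unfolding g_def by (intro has_bochner_integral_mult_right has_bochner_integral_exp_abs_cos bpos)
  have gnn: "0 \<le> g n y" for n y using bpos[of n] assms by (simp add: g_def)
  have gsum: "(\<lambda>n. g n y) sums ((1 - cos (k * y)) * coth_kernel h y)" for y
  proof (cases "y = 0")
    case False
    from sums_mult[OF coth_kernel_sums[OF assms this], of "1 - cos (k * y)"]
    show ?thesis by (simp add: g_def b_def mult_ac)
  qed (simp add: g_def)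
  \<comment> \<open>In this variable k coth(h k) equals (t / h) pi coth(pi t); the term - 1 / t of
    the expansion becomes - 1 / h.\<close>
  define t where "t = h * \<bar>k\<bar> / pi"
  have t: "t > 0" using assms False by (simp add: t_def)
  have "(\<lambda>n. t / h * (2 * t / ((real n + 1)\<^sup>2 + t\<^sup>2))) sums (t / h * (pi * cosh (pi * t) / sinh (pi * t) - 1 / t))"
    by (intro sums_mult coth_partial_fractions t)
  moreover have "t / h * (2 * t / ((real n + 1)\<^sup>2 + t\<^sup>2)) = 1 / h * (2 * k\<^sup>2 / ((b n)\<^sup>2 + k\<^sup>2))" for n
  proof -
    have "k\<^sup>2 = (pi / h)\<^sup>2 * t\<^sup>2" using assms by (simp add: t_def power_mult_distrib power_divide)
    moreover have "(pi / h)\<^sup>2 \<noteq> 0" using assms by simp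
    ultimately have "2 * k\<^sup>2 / ((b n)\<^sup>2 + k\<^sup>2) = ((pi / h)\<^sup>2 * (2 * t\<^sup>2)) / ((pi / h)\<^sup>2 * ((real n + 1)\<^sup>2 + t\<^sup>2))"
      by (simp only: b_def power_mult_distrib distrib_left[of "(pi / h)\<^sup>2"] mult.left_commute[of 2])
    also have "\<dots> = 2 * t\<^sup>2 / ((real n + 1)\<^sup>2 + t\<^sup>2)"
      using \<open>(pi / h)\<^sup>2 \<noteq> 0\<close> by (rule mult_divide_mult_cancel_left)
    finally show ?thesis by (simp add: power2_eq_square)
  qed
  moreover have "t / h * (pi * cosh (pi * t) / sinh (pi * t) - 1 / t) = kcoth h k - 1 / h"
    using t assms False by (simp add: t_def kcoth_def right_diff_distrib)
  ultimately have isums: "(\<lambda>n. LINT y|lborel. g n y) sums (kcoth h k - 1 / h)"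
    by (simp add: gint[THEN has_bochner_integral_integral_eq])
  have gi: "integrable lborel (g n)" for n using gint by (rule integrable.intros)
  have 1: "AE y in lborel. summable (\<lambda>n. norm (g n y))"
    using gsum gnn by (simp add: sums_iff)
  have 2: "summable (\<lambda>n. LINT y|lborel. norm (g n y))"
    using isums gnn by (simp add: sums_iff)
  have "(\<lambda>y. \<Sum>n. g n y) = (\<lambda>y. (1 - cos (k * y)) * coth_kernel h y)"
    using gsum by (simp add: sums_iff)
  moreover have "integrable lborel (\<lambda>y. \<Sum>n. g n y)" by (rule integrable_suminf[OF gi 1 2])
  moreover have "(LINT y|lborel. (\<Sum>n. g n y)) = kcoth h k - 1 / h"
    using sums_unique2[OF sums_integral[OF gi 1 2] isums] .
  ultimately show ?thesis by (simp add: has_bochner_integral_iff)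
qed

section \<open>Size and exponential moments of the kernel\<close>

lemma le_sinh: fixes u :: real assumes "0 \<le> u" shows "u \<le> sinh u"
proof -
  have "(sinh 0 - 0) \<le> sinh u - u"
    by (rule DERIV_nonneg_imp_nondecreasing[OF assms])
       (auto intro!: derivative_eq_intros exI cosh_real_ge_1 simp: algebra_simps)
  then show ?thesis by simp
qed

lemma sinh_le_mult_cosh: fixes u :: real assumes "0 \<le> u" shows "sinh u \<le> u * cosh u"
proof -
  have "0 * cosh 0 - sinh 0 \<le> u * cosh u - sinh u"
    by (rule DERIV_nonneg_imp_nondecreasing[OF assms])
       (auto intro!: derivative_eq_intros exI)
  then show ?thesis by simp
qed

lemma cosh_minus_one_le: "cosh x - 1 \<le> x\<^sup>2 / 2 * exp \<bar>x\<bar>" for x :: real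
proof -
  define u where "u = \<bar>x\<bar> / 2"
  have u: "0 \<le> u" by (simp add: u_def)
  have "cosh x = cosh (2 * u)" by (simp add: u_def abs_if)
  then have "cosh x - 1 = 2 * (sinh u)\<^sup>2"
    by (simp add: cosh_double_cosh cosh_square_eq)
  also have "\<dots> \<le> 2 * (u * cosh u)\<^sup>2"
    using u by (intro mult_left_mono power_mono sinh_le_mult_cosh) auto
  also have "\<dots> \<le> 2 * (u * exp u)\<^sup>2"
    using u by (intro mult_left_mono power_mono) (auto simp: cosh_def)
  also have "\<dots> = x\<^sup>2 / 2 * exp \<bar>x\<bar>"
    by (simp add: u_def power_mult_distrib power_divide flip: exp_double)
  finally show ?thesis .
qed

text \<open>In sinh(2 u) = 2 sinh(u) cosh(u) the two factors do different work: sinh(u) >= u cancels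
  the singularity against y^2, and cosh(u) >= exp(u) / 2 supplies the decay, at half the true
  rate.\<close>

lemma coth_kernel_bound:
  assumes "h > 0"
  shows "y\<^sup>2 * coth_kernel h y \<le> 2 * exp (- (pi / (2 * h)) * \<bar>y\<bar>)"
proof (cases "y = 0")
  case False
  define u where "u = pi * \<bar>y\<bar> / (4 * h)"
  have u: "u > 0" using assms False by (simp add: u_def)
  have "(sinh (pi * y / (2 * h)))\<^sup>2 = (sinh (2 * u))\<^sup>2"
    using assms False by (cases "y > 0") (simp_all add: u_def)
  also have "\<dots> = 4 * (sinh u)\<^sup>2 * (cosh u)\<^sup>2" by (simp add: sinh_double power_mult_distrib)
  also have "\<dots> \<ge> 4 * u\<^sup>2 * (exp u / 2)\<^sup>2"
    using u by (intro mult_mono power_mono le_sinh) (auto simp: cosh_def)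
  finally have *: "u\<^sup>2 * exp (2 * u) \<le> (sinh (pi * y / (2 * h)))\<^sup>2"
    by (simp add: power_divide exp_double)
  have "0 < u\<^sup>2 * exp (2 * u)" using u by simp
  then have "coth_kernel h y \<le> pi / (4 * h\<^sup>2 * (u\<^sup>2 * exp (2 * u)))"
    unfolding coth_kernel_def using assms order.strict_trans2[OF _ *] *
    by (intro divide_left_mono mult_left_mono mult_pos_pos) auto
  then have "y\<^sup>2 * coth_kernel h y \<le> y\<^sup>2 * (pi / (4 * h\<^sup>2 * (u\<^sup>2 * exp (2 * u))))"
    by (rule mult_left_mono) simp
  also have "\<dots> = 4 / pi * exp (- (2 * u))"
    using assms False by (simp add: u_def power_mult_distrib power_divide exp_minus field_simps power2_eq_square)
  also have "\<dots> \<le> 2 * exp (- (2 * u))"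
    using pi_gt3 by (intro mult_right_mono) (auto simp: field_simps)
  finally show ?thesis by (simp add: u_def)
qed simp

lemma coth_kernel_exp_moment:
  fixes h \<tau> :: real
  assumes "h > 0" "\<tau> > 0"
  obtains \<eta> where "\<eta> > 0" "integrable lborel (\<lambda>y. (cosh (\<eta> * y) - 1) * coth_kernel h y)"
    "(LINT y|lborel. (cosh (\<eta> * y) - 1) * coth_kernel h y) \<le> \<tau>"
proof -
  define a where "a = pi / (4 * h)"
  have a: "a > 0" using assms by (simp add: a_def)
  \<comment> \<open>The kernel bound decays at rate 2 a. The weight cosh(\<eta> y) - 1 costs at most
    a of it because \<eta> <= a, and the remaining integral is \<eta>^2 (2 / a), which the second
    argument of the minimum keeps below \<tau>.\<close>
  define \<eta> where "\<eta> = min a (sqrt (\<tau> * a / 2))"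
  have \<eta>: "\<eta> > 0" "\<eta> \<le> a" using a assms by (auto simp: \<eta>_def)
  have "\<eta>\<^sup>2 \<le> (sqrt (\<tau> * a / 2))\<^sup>2"
    using \<eta>(1) by (intro power_mono) (auto simp: \<eta>_def)
  then have \<eta>2: "\<eta>\<^sup>2 * (2 / a) \<le> \<tau>" using a assms by (simp add: field_simps)
  have bd: "(cosh (\<eta> * y) - 1) * coth_kernel h y \<le> \<eta>\<^sup>2 * exp (- a * \<bar>y\<bar>)" for y
  proof -
    have "(cosh (\<eta> * y) - 1) * coth_kernel h y \<le> ((\<eta> * y)\<^sup>2 / 2 * exp \<bar>\<eta> * y\<bar>) * coth_kernel h y"
      by (intro mult_right_mono cosh_minus_one_le coth_kernel_nonneg)
    also have "\<dots> = \<eta>\<^sup>2 / 2 * exp (\<eta> * \<bar>y\<bar>) * (y\<^sup>2 * coth_kernel h y)"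
      using \<eta> by (simp add: power_mult_distrib abs_mult)
    also have "\<dots> \<le> \<eta>\<^sup>2 / 2 * exp (a * \<bar>y\<bar>) * (2 * exp (- (pi / (2 * h)) * \<bar>y\<bar>))"
      using \<eta> by (intro mult_mono coth_kernel_bound assms mult_right_mono) (auto simp: coth_kernel_nonneg intro!: mult_right_mono)
    also have "\<dots> = \<eta>\<^sup>2 * exp (- a * \<bar>y\<bar>)"
      by (simp add: a_def field_simps flip: exp_add)
    finally show ?thesis .
  qed
  have nn: "0 \<le> (cosh (\<eta> * y) - 1) * coth_kernel h y" for y
    using cosh_real_ge_1 by (simp add: coth_kernel_nonneg)
  have [measurable]: "(\<lambda>y::real. cosh (\<eta> * y)) \<in> borel_measurable borel"
    by (intro borel_measurable_continuous_onI continuous_intros)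
  have i: "integrable lborel (\<lambda>y. \<eta>\<^sup>2 * exp (- a * \<bar>y\<bar>))"
    by (intro integrable_mult_right integrable_exp_abs a)
  have "integrable lborel (\<lambda>y. (cosh (\<eta> * y) - 1) * coth_kernel h y)"
    by (rule Bochner_Integration.integrable_bound[OF i]) (use bd nn in auto)
  moreover have "(LINT y|lborel. (cosh (\<eta> * y) - 1) * coth_kernel h y) \<le> (LINT y|lborel. \<eta>\<^sup>2 * exp (- a * \<bar>y\<bar>))"
    by (intro integral_mono i bd calculation)
  ultimately show thesis
    using that[OF \<eta>(1)] \<eta>2 integral_exp_abs[OF a] by simp
qed

section \<open>Fourier inversion for test functions\<close>

text \<open>Reduces the integrability hypothesis of each later use of Fubini to a pointwise bound by
  a product.\<close>

lemma lborel_pair_integrable_bound: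
  fixes F :: "real \<times> real \<Rightarrow> 'a::{banach, second_countable_topology}" and f g :: "real \<Rightarrow> real"
  assumes [measurable]: "F \<in> borel_measurable (lborel \<Otimes>\<^sub>M lborel)"
    and f: "integrable lborel f" and g: "integrable lborel g"
    and bound: "\<And>x y. norm (F (x, y)) \<le> f x * g y"
  shows "integrable (lborel \<Otimes>\<^sub>M lborel) F"
proof (rule lborel_pair.Fubini_integrable)
  have *: "integrable lborel (\<lambda>y. F (x, y))" for x
    by (rule Bochner_Integration.integrable_bound[OF integrable_mult_right[OF g, of "f x"]])
       (use bound[of x] in \<open>auto intro!: always_eventually intro: order_trans[OF _ abs_ge_self]\<close>)
  then show "AE x in lborel. integrable lborel (\<lambda>y. F (x, y))" by simp
  have "norm (LINT y|lborel. norm (F (x, y))) \<le> norm (f x * (LINT y|lborel. g y))" for x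
  proof -
    have "(LINT y|lborel. norm (F (x, y))) \<le> (LINT y|lborel. f x * g y)"
      by (intro integral_mono integrable_norm * integrable_mult_right g bound)
    then show ?thesis by simp
  qed
  then show "integrable lborel (\<lambda>x. LINT y|lborel. norm (F (x, y)))"
    by (intro Bochner_Integration.integrable_bound[OF integrable_mult_left[OF f, of "LINT y|lborel. g y"]]) auto
qed fact

lemma cis_measurable [measurable]: "cis \<in> borel_measurable borel"
  by (intro borel_measurable_continuous_onI continuous_intros)

lemma fourier_measurable [measurable]:
  assumes [measurable]: "\<phi> \<in> borel_measurable borel"
  shows "fourier \<phi> \<in> borel_measurable borel"
  unfolding fourier_def[abs_def] by measurable

lemma integrable_times_cis:
  fixes f :: "real \<Rightarrow> complex"
  assumes "integrable lborel f" "g \<in> borel_measurable borel"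
  shows "integrable lborel (\<lambda>x. f x * cis (g x))"
proof (rule Bochner_Integration.integrable_bound[OF assms(1)])
  have [measurable]: "f \<in> borel_measurable lborel" using assms by auto
  note assms(2)[measurable]
  show "(\<lambda>x. f x * cis (g x)) \<in> borel_measurable lborel" by measurable
qed (simp add: norm_mult)

lemma fourier_deriv:
  assumes "test_fun \<phi>"
  shows "fourier (deriv \<phi>) k = \<i> * k * fourier \<phi> k"
proof -
  obtain R where R: "R > 0" "\<And>x. R < \<bar>x\<bar> \<Longrightarrow> \<phi> x = 0" using test_fun_support[OF assms] by metis
  note t' = test_fun_deriv[OF assms]
  obtain R' where R': "R' > 0" "\<And>x. R' < \<bar>x\<bar> \<Longrightarrow> deriv \<phi> x = 0" using test_fun_support[OF t'] by metis
  \<comment> \<open>The supports are controlled only strictly beyond R and R', so the endpoints must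
    lie strictly outside; the added 1 ensures it.\<close>
  define S where "S = max R R' + 1"
  define f where "f = (\<lambda>x. complex_of_real (deriv \<phi> x) * cis (- (k * x)) + complex_of_real (\<phi> x) * (- \<i> * k * cis (- (k * x))))"
  have d: "((\<lambda>x. complex_of_real (\<phi> x) * cis (- (k * x))) has_vector_derivative f x) (at x within A)" for x A
  proof -
    have "((\<lambda>z. exp (- \<i> * k * z)) has_field_derivative (- \<i> * k) * exp (- \<i> * k * of_real x)) (at (of_real x))"
      by (auto intro!: derivative_eq_intros)
    then have "((\<lambda>x. exp (- \<i> * k * of_real x)) has_vector_derivative (- \<i> * k) * exp (- \<i> * k * of_real x)) (at x)"
      by (rule has_vector_derivative_real_field)
    then have "((\<lambda>x. cis (- (k * x))) has_vector_derivative (- \<i> * k * cis (- (k * x)))) (at x)"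
      by (simp add: cis_conv_exp mult.assoc)
    moreover have "((\<lambda>x. complex_of_real (\<phi> x)) has_vector_derivative complex_of_real (deriv \<phi> x)) (at x)"
      using test_fun_DERIV[OF assms, of x] by (intro has_vector_derivative_of_real) (simp add: has_real_derivative_iff_has_vector_derivative)
    ultimately have "((\<lambda>x. complex_of_real (\<phi> x) * cis (- (k * x))) has_vector_derivative
        complex_of_real (\<phi> x) * (- \<i> * k * cis (- (k * x))) + complex_of_real (deriv \<phi> x) * cis (- (k * x))) (at x)"
      by (intro has_vector_derivative_mult)
    then show ?thesis by (simp add: f_def add.commute has_vector_derivative_at_within)
  qed
  have "(LINT x|lborel. indicator {-S..S} x *\<^sub>R f x) = complex_of_real (\<phi> S) * cis (- (k * S)) - complex_of_real (\<phi> (-S)) * cis (- (k * (-S)))"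
  proof (rule integral_FTC_Icc)
    show "continuous_on {-S..S} f"
      unfolding f_def by (intro continuous_intros test_fun_continuous assms t')
  qed (use d R(1) in \<open>auto simp: S_def\<close>)
  also have "\<dots> = 0" using R(1) by (simp add: R(2) S_def)
  also have "(\<lambda>x. indicator {-S..S} x *\<^sub>R f x) = f"
  proof
    fix x
    show "indicator {-S..S} x *\<^sub>R f x = f x"
      using R(2)[of x] R'(2)[of x] by (auto simp: f_def S_def split: split_indicator)
  qed
  finally have "(LINT x|lborel. f x) = 0" .
  moreover have "integrable lborel (\<lambda>x. complex_of_real (\<phi> x) * cis (- (k * x)))"
      "integrable lborel (\<lambda>x. complex_of_real (deriv \<phi> x) * cis (- (k * x)))"
    by (intro integrable_times_cis integrable_of_real test_fun_integrable assms t'; measurable)+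
  then have "(LINT x|lborel. f x) = fourier (deriv \<phi>) k + (LINT x|lborel. (- \<i> * k) * (complex_of_real (\<phi> x) * cis (- (k * x))))"
    unfolding fourier_def f_def by (subst Bochner_Integration.integral_add[symmetric]) (auto simp: mult_ac)
  ultimately show ?thesis by (simp add: fourier_def)
qed

lemma norm_fourier_le: "norm (fourier \<phi> k) \<le> (LINT x|lborel. \<bar>\<phi> x\<bar>)"
  unfolding fourier_def by (rule order_trans[OF integral_norm_bound]) (simp add: norm_mult)

text \<open>Four derivatives leave decay 1 / (1 + k^2) after multiplication by a symbol of quadratic
  growth, and i^4 = 1 avoids signs.\<close>

lemma fourier_decay:
  assumes "test_fun \<phi>"
  obtains C where "C > 0" "\<And>k. norm (fourier \<phi> k) * (1 + k ^ 4) \<le> C"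
proof -
  define \<psi> where "\<psi> = deriv (deriv (deriv (deriv \<phi>)))"
  have \<psi>: "fourier \<psi> k = k ^ 4 * fourier \<phi> k" for k
  proof -
    have "fourier \<psi> k = \<i> * k * (\<i> * k * (\<i> * k * (\<i> * k * fourier \<phi> k)))"
      by (simp only: \<psi>_def fourier_deriv test_fun_deriv assms)
    also have "\<dots> = (\<i> * \<i>) * (\<i> * \<i>) * (k ^ 4 * fourier \<phi> k)"
      by (simp only: power4_eq_xxxx of_real_mult mult_ac)
    finally show ?thesis by simp
  qed
  have "norm (fourier \<phi> k) * (1 + k ^ 4) \<le> (LINT x|lborel. \<bar>\<phi> x\<bar>) + (LINT x|lborel. \<bar>\<psi> x\<bar>) + 1" for k
    using norm_fourier_le[of \<phi> k] norm_fourier_le[of \<psi> k] by (simp add: \<psi> norm_mult norm_power algebra_simps)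
  moreover have "(LINT x|lborel. \<bar>\<phi> x\<bar>) + (LINT x|lborel. \<bar>\<psi> x\<bar>) + 1 > 0"
    by (intro add_nonneg_pos add_nonneg_nonneg Bochner_Integration.integral_nonneg) auto
  ultimately show thesis using that by blast
qed

lemma integrable_inverse_one_plus_square: "integrable lborel (\<lambda>k::real. 1 / (1 + k\<^sup>2))"
proof -
  have "has_bochner_integral lborel (\<lambda>k::real. 1 / (1 + k\<^sup>2)) (2 * (pi / 2 - arctan 0))"
    by (rule has_bochner_integral_even_FTC)
       (auto intro!: derivative_eq_intros tendsto_arctan_at_top simp: inverse_eq_divide add_nonneg_eq_0_iff)
  then show ?thesis by (rule integrable.intros)
qed

lemma integrable_fourier_weighted:
  assumes "test_fun \<phi>" and [measurable]: "m \<in> borel_measurable borel" and m: "\<And>k. \<bar>m k\<bar> \<le> B * (1 + k\<^sup>2)"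
  shows "integrable lborel (\<lambda>k. complex_of_real (m k) * fourier \<phi> k)"
proof -
  have [measurable]: "\<phi> \<in> borel_measurable borel" using assms by (intro test_fun_measurable)
  obtain C where C: "C > 0" "\<And>k. norm (fourier \<phi> k) * (1 + k ^ 4) \<le> C" using fourier_decay[OF assms(1)] by metis
  have B: "0 \<le> B" using m[of 0] by simp
  have "norm (complex_of_real (m k) * fourier \<phi> k) \<le> 2 * B * C * (1 / (1 + k\<^sup>2))" for k
  proof -
    have k4: "(1 + k\<^sup>2) * (1 + k\<^sup>2) \<le> 2 * (1 + k ^ 4)"
      using sum_squares_bound[of 1 "k\<^sup>2"] by (simp add: algebra_simps power4_eq_xxxx power2_eq_square)
    have "norm (complex_of_real (m k) * fourier \<phi> k) * (1 + k\<^sup>2) = \<bar>m k\<bar> * (1 + k\<^sup>2) * norm (fourier \<phi> k)"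
      by (simp add: norm_mult)
    also have "\<dots> \<le> (B * (1 + k\<^sup>2)) * (1 + k\<^sup>2) * norm (fourier \<phi> k)"
      by (intro mult_right_mono m) auto
    also have "\<dots> = B * norm (fourier \<phi> k) * ((1 + k\<^sup>2) * (1 + k\<^sup>2))" by simp
    also have "\<dots> \<le> B * norm (fourier \<phi> k) * (2 * (1 + k ^ 4))"
      by (intro mult_left_mono) (use B k4 in auto)
    also have "\<dots> = 2 * B * (norm (fourier \<phi> k) * (1 + k ^ 4))" by simp
    also have "\<dots> \<le> 2 * B * C" using B C by (intro mult_left_mono) auto
    finally show ?thesis by (simp add: pos_le_divide_eq add_pos_nonneg)
  qed
  then show ?thesis
    by (intro Bochner_Integration.integrable_bound[OF integrable_mult_right[OF integrable_inverse_one_plus_square, of "2 * B * C"]])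
       (use B C(1) in \<open>auto simp: abs_of_nonneg\<close>)
qed

lemma integrable_fourier: "test_fun \<phi> \<Longrightarrow> integrable lborel (fourier \<phi>)"
  using integrable_fourier_weighted[of \<phi> "\<lambda>_. 1" 1] by simp

section \<open>Fourier inversion by Gaussian summation\<close>

lemma integrable_std_normal_density: "integrable lborel std_normal_density"
  using integrable_std_normal_moment[of 0] by simp

text \<open>The characteristic function of the standard normal law, rescaled by s.\<close>

lemma integral_std_normal_density_cis:
  assumes "s > 0"
  shows "(LINT k|lborel. complex_of_real (std_normal_density (s * k)) * cis (k * t)) =
         complex_of_real (sqrt (2 * pi) / s * std_normal_density (t / s))"
proof -
  have "(LINT k|lborel. complex_of_real (std_normal_density k) * cis (k * (t / s))) =
      \<bar>s\<bar> *\<^sub>R (LINT k|lborel. complex_of_real (std_normal_density (0 + s * k)) * cis ((0 + s * k) * (t / s)))"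
    using assms by (intro lborel_integral_real_affine) auto
  moreover have "(LINT k|lborel. complex_of_real (std_normal_density k) * cis (k * (t / s))) = char std_normal_distribution (t / s)"
    unfolding char_def by (subst integral_density) (auto simp: cis_conv_exp scaleR_conv_of_real mult_ac)
  moreover have "(LINT k|lborel. complex_of_real (std_normal_density (0 + s * k)) * cis ((0 + s * k) * (t / s))) =
      (LINT k|lborel. complex_of_real (std_normal_density (s * k)) * cis (k * t))" (is "_ = ?X")
    using assms by (simp add: mult_ac)
  ultimately have "s *\<^sub>R ?X = complex_of_real (exp (- (t / s)\<^sup>2 / 2))"
    using assms unfolding char_std_normal_distribution by simp
  moreover have "exp (- (t / s)\<^sup>2 / 2) = s * (sqrt (2 * pi) / s * std_normal_density (t / s))"
    using assms by (simp add: std_normal_density_def)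
  ultimately have "s *\<^sub>R ?X = s *\<^sub>R complex_of_real (sqrt (2 * pi) / s * std_normal_density (t / s))"
    by (simp only: scaleR_conv_of_real of_real_mult)
  then show ?thesis using assms by simp
qed

text \<open>The Gaussian factor makes the double integral over k and y absolutely convergent, so
  Fubini applies; the substitution y = x - s u then exhibits an average of \<open>\<phi>\<close>
  around x on the scale s.\<close>

lemma fourier_gaussian_average:
  assumes "test_fun \<phi>" "s > 0"
  shows "(LINT k|lborel. complex_of_real (std_normal_density (s * k)) * (fourier \<phi> k * cis (k * x))) =
         complex_of_real (sqrt (2 * pi) * (LINT u|lborel. \<phi> (x - s * u) * std_normal_density u))"
proof -
  have [measurable]: "\<phi> \<in> borel_measurable borel" using assms by (intro test_fun_measurable)
  define F where "F = (\<lambda>(k, y). complex_of_real (std_normal_density (s * k)) * (complex_of_real (\<phi> y) * cis (k * (x - y))))"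
  have [measurable]: "F \<in> borel_measurable (lborel \<Otimes>\<^sub>M lborel)" unfolding F_def by measurable
  have si: "integrable lborel (\<lambda>k. std_normal_density (s * k))"
    using lborel_integrable_real_affine[OF integrable_std_normal_density, of s 0] assms by simp
  have Fi: "integrable (lborel \<Otimes>\<^sub>M lborel) F"
    by (rule lborel_pair_integrable_bound[OF _ si integrable_abs[OF test_fun_integrable[OF assms(1)]]])
       (auto simp: F_def norm_mult)
  have "(LINT k|lborel. complex_of_real (std_normal_density (s * k)) * (fourier \<phi> k * cis (k * x))) =
        (LINT k|lborel. LINT y|lborel. F (k, y))"
  proof (rule Bochner_Integration.integral_cong)
    fix k :: real
    have "fourier \<phi> k * cis (k * x) = (LINT y|lborel. complex_of_real (\<phi> y) * cis (- (k * y)) * cis (k * x))"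
      unfolding fourier_def by simp
    then show "complex_of_real (std_normal_density (s * k)) * (fourier \<phi> k * cis (k * x)) = (LINT y|lborel. F (k, y))"
      by (simp add: F_def cis_mult right_diff_distrib mult.assoc)
  qed simp
  also have "\<dots> = (LINT y|lborel. LINT k|lborel. F (k, y))"
    using Fi by (intro lborel_pair.Fubini_integral[symmetric]) simp
  also have "\<dots> = (LINT y|lborel. complex_of_real (\<phi> y * (sqrt (2 * pi) / s * std_normal_density ((x - y) / s))))"
  proof (rule Bochner_Integration.integral_cong)
    fix y :: real
    have "(LINT k|lborel. F (k, y)) = (LINT k|lborel. complex_of_real (\<phi> y) * (complex_of_real (std_normal_density (s * k)) * cis (k * (x - y))))"
      by (simp add: F_def mult_ac)
    then show "(LINT k|lborel. F (k, y)) = complex_of_real (\<phi> y * (sqrt (2 * pi) / s * std_normal_density ((x - y) / s)))"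
      by (simp add: integral_std_normal_density_cis[OF assms(2)])
  qed simp
  also have "\<dots> = complex_of_real (LINT y|lborel. \<phi> y * (sqrt (2 * pi) / s * std_normal_density ((x - y) / s)))"
    by (rule integral_complex_of_real)
  also have "(LINT y|lborel. \<phi> y * (sqrt (2 * pi) / s * std_normal_density ((x - y) / s))) =
      \<bar>- s\<bar> *\<^sub>R (LINT u|lborel. \<phi> (x + - s * u) * (sqrt (2 * pi) / s * std_normal_density ((x - (x + - s * u)) / s)))"
    using assms by (intro lborel_integral_real_affine) auto
  also have "\<dots> = (LINT u|lborel. s * (\<phi> (x + - s * u) * (sqrt (2 * pi) / s * std_normal_density ((x - (x + - s * u)) / s))))"
    using assms by simp
  also have "\<dots> = (LINT u|lborel. sqrt (2 * pi) * (\<phi> (x - s * u) * std_normal_density u))"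
    using assms by (intro Bochner_Integration.integral_cong) (auto simp: field_simps)
  finally show ?thesis by simp
qed

text \<open>Let s tend to 0 in the Gaussian average, by dominated convergence on both sides: the
  frequency side loses its cutoff, and the space side concentrates at x. The factor 2 pi is sqrt(2
  pi) divided by the normal density at 0.\<close>

lemma fourier_inversion:
  assumes "test_fun \<phi>"
  shows "(LINT k|lborel. fourier \<phi> k * cis (k * x)) = complex_of_real (2 * pi * \<phi> x)"
proof -
  have [measurable]: "\<phi> \<in> borel_measurable borel" using assms by (intro test_fun_measurable)
  obtain B where B: "B > 0" "\<And>x. \<bar>\<phi> x\<bar> \<le> B" using test_fun_bounded[OF assms] by metis
  define s where "s = (\<lambda>n. 1 / real (Suc n))"
  have s: "s n > 0" for n by (simp add: s_def)
  have s0: "s \<longlonglongrightarrow> 0" unfolding s_def by real_asymp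
  have cont: "continuous_on UNIV (std_normal_density :: real \<Rightarrow> real)"
    unfolding std_normal_density_def[abs_def] by (intro continuous_intros) auto
  have le: "std_normal_density u \<le> std_normal_density 0" for u
    by (simp add: std_normal_density_def divide_right_mono)
  have "(\<lambda>n. LINT k|lborel. complex_of_real (std_normal_density (s n * k)) * (fourier \<phi> k * cis (k * x)))
      \<longlonglongrightarrow> (LINT k|lborel. complex_of_real (std_normal_density 0) * (fourier \<phi> k * cis (k * x)))"
  proof (rule integral_dominated_convergence)
    show "integrable lborel (\<lambda>k. std_normal_density 0 * norm (fourier \<phi> k))"
      by (intro integrable_mult_right integrable_norm integrable_fourier assms)
    show "AE k in lborel. (\<lambda>n. complex_of_real (std_normal_density (s n * k)) * (fourier \<phi> k * cis (k * x)))
        \<longlonglongrightarrow> complex_of_real (std_normal_density 0) * (fourier \<phi> k * cis (k * x))"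
    proof (intro always_eventually allI tendsto_intros)
      fix k
      have "(\<lambda>n. s n * k) \<longlonglongrightarrow> 0 * k" by (intro tendsto_intros s0)
      then show "(\<lambda>n. std_normal_density (s n * k)) \<longlonglongrightarrow> std_normal_density 0"
        by (intro continuous_on_tendsto_compose[OF cont]) auto
    qed
    show "AE k in lborel. norm (complex_of_real (std_normal_density (s n * k)) * (fourier \<phi> k * cis (k * x)))
        \<le> std_normal_density 0 * norm (fourier \<phi> k)" for n
      by (intro always_eventually allI) (auto simp: norm_mult intro!: mult_right_mono le)
  qed measurable
  moreover have "(\<lambda>n. LINT u|lborel. \<phi> (x - s n * u) * std_normal_density u)
      \<longlonglongrightarrow> (LINT u|lborel. \<phi> x * std_normal_density u)"
  proof (rule integral_dominated_convergence)
    show "integrable lborel (\<lambda>u. B * std_normal_density u)"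
      by (intro integrable_mult_right integrable_std_normal_density)
    show "AE u in lborel. (\<lambda>n. \<phi> (x - s n * u) * std_normal_density u) \<longlonglongrightarrow> \<phi> x * std_normal_density u"
    proof (intro always_eventually allI tendsto_intros)
      fix u
      have "(\<lambda>n. x - s n * u) \<longlonglongrightarrow> x - 0 * u" by (intro tendsto_intros s0)
      then show "(\<lambda>n. \<phi> (x - s n * u)) \<longlonglongrightarrow> \<phi> x"
        by (intro continuous_on_tendsto_compose[OF test_fun_continuous[OF assms, of UNIV]]) auto
    qed
    show "AE u in lborel. norm (\<phi> (x - s n * u) * std_normal_density u) \<le> B * std_normal_density u" for n
      using B by (intro always_eventually allI) (auto simp: abs_mult intro!: mult_right_mono)
  qed measurable
  moreover have "(LINT u|lborel. std_normal_density u) = 1"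
    using integral_std_normal_moment_even[of 0] by simp
  ultimately have "complex_of_real (std_normal_density 0) * (LINT k|lborel. fourier \<phi> k * cis (k * x)) =
      complex_of_real (sqrt (2 * pi) * \<phi> x)"
    unfolding fourier_gaussian_average[OF assms s]
    by (intro LIMSEQ_unique[where X="\<lambda>n. complex_of_real (sqrt (2 * pi) * (LINT u|lborel. \<phi> (x - s n * u) * std_normal_density u))"])
       (auto intro!: tendsto_intros)
  then have "complex_of_real (sqrt (2 * pi)) * (complex_of_real (std_normal_density 0) * (LINT k|lborel. fourier \<phi> k * cis (k * x))) =
      complex_of_real (sqrt (2 * pi)) * complex_of_real (sqrt (2 * pi) * \<phi> x)"
    by simp
  moreover have "sqrt (2 * pi) * std_normal_density 0 = 1"
    by (simp add: std_normal_density_def)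
  ultimately show ?thesis by (simp add: mult.assoc[symmetric] of_real_mult[symmetric] del: of_real_mult)
qed

section \<open>Integral representation of the multiplier\<close>

lemma one_minus_cos_le: "1 - cos u \<le> u\<^sup>2 / 2" for u :: real
proof -
  have "cos u = 1 - 2 * (sin (u / 2))\<^sup>2"
    using cos_double_sin[of "u / 2"] by simp
  moreover have "(sin (u / 2))\<^sup>2 \<le> (u / 2)\<^sup>2"
    using abs_sin_x_le_abs_x[of "u / 2"] by (simp only: abs_le_square_iff)
  ultimately show ?thesis by (simp add: power_divide)
qed

lemma one_minus_cos_coth_kernel_le:
  assumes "h > 0"
  shows "(1 - cos (k * y)) * coth_kernel h y \<le> k\<^sup>2 * exp (- (pi / (2 * h)) * \<bar>y\<bar>)"
proof -
  have "(1 - cos (k * y)) * coth_kernel h y \<le> (k * y)\<^sup>2 / 2 * coth_kernel h y"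
    by (intro mult_right_mono one_minus_cos_le coth_kernel_nonneg)
  also have "\<dots> = k\<^sup>2 / 2 * (y\<^sup>2 * coth_kernel h y)" by (simp add: power_mult_distrib)
  also have "\<dots> \<le> k\<^sup>2 / 2 * (2 * exp (- (pi / (2 * h)) * \<bar>y\<bar>))"
    by (intro mult_left_mono coth_kernel_bound assms) auto
  finally show ?thesis by simp
qed

lemma kcoth_measurable [measurable]: "kcoth h \<in> borel_measurable borel"
proof -
  have [measurable]: "(\<lambda>k. cosh (h * \<bar>k\<bar>)) \<in> borel_measurable borel" "(\<lambda>k. sinh (h * \<bar>k\<bar>)) \<in> borel_measurable borel"
    by (intro borel_measurable_continuous_onI continuous_intros)+
  show ?thesis unfolding kcoth_def[abs_def] by measurable
qed

text \<open>Read off from the kernel and 1 - cos(u) <= u^2 / 2. Quadratic growth is far from sharp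
  but suffices against the fourth-order decay of Fourier transforms.\<close>

lemma kcoth_bound:
  assumes "h > 0"
  obtains B where "\<And>k. \<bar>kcoth h k\<bar> \<le> B * (1 + k\<^sup>2)"
proof -
  define a where "a = pi / (2 * h)"
  have a: "a > 0" using assms by (simp add: a_def)
  have "\<bar>kcoth h k\<bar> \<le> (1 / h + 2 / a) * (1 + k\<^sup>2)" for k
  proof -
    note J = has_bochner_integral_coth_kernel_cos[OF assms, of k]
    have eq: "kcoth h k - 1 / h = (LINT y|lborel. (1 - cos (k * y)) * coth_kernel h y)"
      using has_bochner_integral_integral_eq[OF J] by simp
    have "0 \<le> (LINT y|lborel. (1 - cos (k * y)) * coth_kernel h y)"
      by (intro Bochner_Integration.integral_nonneg) (simp add: coth_kernel_nonneg)
    then have "0 \<le> kcoth h k - 1 / h" by (simp only: eq)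
    moreover have "(LINT y|lborel. (1 - cos (k * y)) * coth_kernel h y) \<le> (LINT y|lborel. k\<^sup>2 * exp (- a * \<bar>y\<bar>))"
      unfolding a_def
      by (intro integral_mono one_minus_cos_coth_kernel_le assms integrable.intros[OF J] integrable_mult_right integrable_exp_abs)
         (use assms in auto)
    then have "kcoth h k - 1 / h \<le> k\<^sup>2 * (2 / a)" by (simp only: eq integral_exp_abs[OF a] integral_mult_right_zero)
    moreover have "0 \<le> 1 / h * k\<^sup>2" "0 \<le> 2 / a" "0 < 1 / h" using assms a by auto
    ultimately show ?thesis by (simp only: distrib_left distrib_right mult.commute[of "k\<^sup>2"])
  qed
  then show thesis using that by blast
qed

text \<open>The constant symbol acts as the identity by Fourier inversion. This reduces both
  operators of the system to K.\<close>

lemma fmult_affine_kcoth: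
  assumes "test_fun \<phi>" "h > 0"
  shows "fmult (\<lambda>k. p + q * kcoth h k) \<phi> x = p * \<phi> x + q * fmult (kcoth h) \<phi> x"
proof -
  obtain B where B: "\<And>k. \<bar>kcoth h k\<bar> \<le> B * (1 + k\<^sup>2)" using kcoth_bound[OF assms(2)] by metis
  have i: "integrable lborel (\<lambda>k. fourier \<phi> k * cis (k * x))"
    "integrable lborel (\<lambda>k. complex_of_real (kcoth h k) * fourier \<phi> k * cis (k * x))"
    by (intro integrable_times_cis integrable_fourier integrable_fourier_weighted[OF _ _ B] assms; measurable)+
  have "(LINT k|lborel. complex_of_real (p + q * kcoth h k) * fourier \<phi> k * cis (k * x)) =
      (LINT k|lborel. complex_of_real p * (fourier \<phi> k * cis (k * x)) + complex_of_real q * (complex_of_real (kcoth h k) * fourier \<phi> k * cis (k * x)))"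
    by (simp add: algebra_simps)
  also have "\<dots> = complex_of_real p * (LINT k|lborel. fourier \<phi> k * cis (k * x)) +
      complex_of_real q * (LINT k|lborel. complex_of_real (kcoth h k) * fourier \<phi> k * cis (k * x))"
    using i by (subst Bochner_Integration.integral_add) auto
  finally show ?thesis
    unfolding fmult_def by (simp add: fourier_inversion[OF assms(1)] add_divide_distrib)
qed

text \<open>The symbol is replaced by 1 / h plus its integral over jumps, the order of integration
  is exchanged, and inversion is applied at x, x + y and x - y. The factor k^2 from 1 - cos is
  absorbed by the decay of the Fourier transform.\<close>

theorem fmult_kcoth:
  assumes "test_fun \<phi>" "h > 0"
  shows "fmult (kcoth h) \<phi> x =
    \<phi> x / h + (LINT y|lborel. (2 * \<phi> x - \<phi> (x + y) - \<phi> (x - y)) * coth_kernel h y) / 2"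
proof -
  have [measurable]: "\<phi> \<in> borel_measurable borel" using assms by (intro test_fun_measurable)
  define g where "g = (\<lambda>k. fourier \<phi> k * cis (k * x))"
  have [measurable]: "g \<in> borel_measurable borel" unfolding g_def by measurable
  have gi: "integrable lborel g"
    unfolding g_def by (intro integrable_times_cis integrable_fourier assms; measurable)
  define F where "F = (\<lambda>(k, y). complex_of_real ((1 - cos (k * y)) * coth_kernel h y) * g k)"
  have [measurable]: "F \<in> borel_measurable (lborel \<Otimes>\<^sub>M lborel)" unfolding F_def by measurable
  have k2: "integrable lborel (\<lambda>k. k\<^sup>2 * norm (g k))"
  proof -
    have "integrable lborel (\<lambda>k. norm (complex_of_real (k\<^sup>2) * fourier \<phi> k))"
      by (intro integrable_norm integrable_fourier_weighted[where B=1] assms) auto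
    then show ?thesis by (simp add: g_def norm_mult norm_power)
  qed
  have Fi: "integrable (lborel \<Otimes>\<^sub>M lborel) F"
  proof (rule lborel_pair_integrable_bound[OF _ k2 integrable_exp_abs])
    show "norm (F (k, y)) \<le> k\<^sup>2 * norm (g k) * exp (- (pi / (2 * h)) * \<bar>y\<bar>)" for k y
    proof -
      have "norm (F (k, y)) = (1 - cos (k * y)) * coth_kernel h y * norm (g k)"
        by (simp add: F_def norm_mult coth_kernel_nonneg del: of_real_mult of_real_diff)
      also have "\<dots> \<le> k\<^sup>2 * exp (- (pi / (2 * h)) * \<bar>y\<bar>) * norm (g k)"
        by (intro mult_right_mono one_minus_cos_coth_kernel_le assms) auto
      finally show ?thesis by (simp add: mult_ac)
    qed
  qed (use assms in auto)
  have inner: "(LINT k|lborel. F (k, y)) = complex_of_real (pi * ((2 * \<phi> x - \<phi> (x + y) - \<phi> (x - y)) * coth_kernel h y))" for y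
  proof -
    \<comment> \<open>A cosine in frequency is the mean of the translations by y and - y in
      space.\<close>
    have cc: "complex_of_real (cos (k * y)) * cis (k * x) = (cis (k * (x + y)) + cis (k * (x - y))) / 2" for k
      by (simp add: complex_eq_iff distrib_left right_diff_distrib cos_add cos_diff sin_add sin_diff)
    have i: "integrable lborel (\<lambda>k. fourier \<phi> k * cis (k * z))" for z
      by (intro integrable_times_cis integrable_fourier assms; measurable)
    have "F (k, y) = complex_of_real (coth_kernel h y) *
        (fourier \<phi> k * cis (k * x) - fourier \<phi> k * cis (k * (x + y)) / 2 - fourier \<phi> k * cis (k * (x - y)) / 2)" for k
    proof -
      have "F (k, y) = complex_of_real (coth_kernel h y) * (fourier \<phi> k * (cis (k * x) - complex_of_real (cos (k * y)) * cis (k * x)))"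
        by (simp add: F_def g_def algebra_simps)
      then show ?thesis unfolding cc by (simp add: algebra_simps add_divide_distrib)
    qed
    then have "(LINT k|lborel. F (k, y)) = complex_of_real (coth_kernel h y) *
        ((LINT k|lborel. fourier \<phi> k * cis (k * x)) - (LINT k|lborel. fourier \<phi> k * cis (k * (x + y))) / 2
          - (LINT k|lborel. fourier \<phi> k * cis (k * (x - y))) / 2)"
      using i by (simp add: Bochner_Integration.integral_diff)
    then show ?thesis unfolding fourier_inversion[OF assms(1)] by (simp add: algebra_simps)
  qed
  have "(LINT k|lborel. complex_of_real (kcoth h k) * fourier \<phi> k * cis (k * x)) =
      (LINT k|lborel. complex_of_real (1 / h) * g k + (LINT y|lborel. F (k, y)))"
  proof (rule Bochner_Integration.integral_cong)
    fix k :: real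
    note J = has_bochner_integral_coth_kernel_cos[OF assms(2), of k]
    have "(LINT y|lborel. F (k, y)) = (LINT y|lborel. complex_of_real ((1 - cos (k * y)) * coth_kernel h y)) * g k"
      by (simp add: F_def del: of_real_mult of_real_diff integral_complex_of_real)
    also have "\<dots> = complex_of_real (kcoth h k - 1 / h) * g k"
      unfolding integral_complex_of_real has_bochner_integral_integral_eq[OF J] ..
    finally show "complex_of_real (kcoth h k) * fourier \<phi> k * cis (k * x) = complex_of_real (1 / h) * g k + (LINT y|lborel. F (k, y))"
      by (simp add: g_def algebra_simps)
  qed simp
  also have "\<dots> = complex_of_real (1 / h) * (LINT k|lborel. g k) + (LINT k|lborel. LINT y|lborel. F (k, y))"
    using gi lborel_pair.integrable_fst'[OF Fi] by (subst Bochner_Integration.integral_add) auto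
  also have "(LINT k|lborel. LINT y|lborel. F (k, y)) = (LINT y|lborel. LINT k|lborel. F (k, y))"
    using Fi by (intro lborel_pair.Fubini_integral[symmetric]) simp
  also have "(LINT y|lborel. LINT k|lborel. F (k, y)) =
      complex_of_real (pi * (LINT y|lborel. (2 * \<phi> x - \<phi> (x + y) - \<phi> (x - y)) * coth_kernel h y))"
    unfolding inner integral_complex_of_real by simp
  also have "(LINT k|lborel. g k) = complex_of_real (2 * pi * \<phi> x)"
    unfolding g_def by (rule fourier_inversion[OF assms(1)])
  finally show ?thesis
    unfolding fmult_def by (simp add: field_simps flip: of_real_mult of_real_add)
qed

text \<open>The quadratic order in y is what offsets the y^(-2) singularity of the kernel.\<close>

lemma test_fun_second_difference:
  assumes "test_fun \<phi>"
  obtains M where "M > 0" "\<And>x y. \<bar>2 * \<phi> x - \<phi> (x + y) - \<phi> (x - y)\<bar> \<le> M * y\<^sup>2"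
proof -
  obtain M where M: "M > 0" "\<And>x. \<bar>deriv (deriv \<phi>) x\<bar> \<le> M"
    using test_fun_bounded[OF test_fun_deriv[OF test_fun_deriv[OF assms]]] by metis
  have lip: "\<bar>deriv \<phi> u - deriv \<phi> v\<bar> \<le> M * \<bar>u - v\<bar>" for u v
    using field_differentiable_bound[of UNIV "deriv \<phi>" "deriv (deriv \<phi>)" M u v] M(2)
      test_fun_DERIV[OF test_fun_deriv[OF assms]] by simp
  have "\<bar>2 * \<phi> x - \<phi> (x + y) - \<phi> (x - y)\<bar> \<le> 2 * M * y\<^sup>2" for x y
  proof -
    define g where "g = (\<lambda>t. \<phi> (x + t) + \<phi> (x - t))"
    have "\<bar>g y - g 0\<bar> \<le> (2 * M * \<bar>y\<bar>) * \<bar>y - 0\<bar>"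
    proof (rule field_differentiable_bound[of "{-\<bar>y\<bar>..\<bar>y\<bar>}" g "\<lambda>t. deriv \<phi> (x + t) - deriv \<phi> (x - t)" "2 * M * \<bar>y\<bar>" y 0, unfolded real_norm_def])
      show "(g has_field_derivative deriv \<phi> (x + t) - deriv \<phi> (x - t)) (at t within {-\<bar>y\<bar>..\<bar>y\<bar>})" for t
        unfolding g_def by (rule DERIV_subset[where s=UNIV], (rule derivative_eq_intros DERIV_chain2[OF test_fun_DERIV[OF assms]] refl)+) auto
      show "\<bar>deriv \<phi> (x + t) - deriv \<phi> (x - t)\<bar> \<le> 2 * M * \<bar>y\<bar>" if "t \<in> {-\<bar>y\<bar>..\<bar>y\<bar>}" for t
      proof -
        have "M * \<bar>(x + t) - (x - t)\<bar> \<le> M * (2 * \<bar>y\<bar>)"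
          using that M(1) by (intro mult_left_mono) auto
        with lip[of "x + t" "x - t"] show ?thesis by linarith
      qed
    qed auto
    moreover have "\<bar>2 * \<phi> x - \<phi> (x + y) - \<phi> (x - y)\<bar> = \<bar>g y - g 0\<bar>" by (simp add: g_def)
    ultimately show ?thesis by (simp add: power2_eq_square)
  qed
  with M(1) show thesis by (intro that[of "2 * M"]) auto
qed

section \<open>Mollification and decay of functions in the Sobolev space\<close>

text \<open>The convolution, arranged as \<open>f\<close> tested against a reflected and translated
  \<open>\<rho>\<close>, so that weak equations become pointwise ones for
  \<open>mollify \<rho> f\<close>.\<close>

definition mollify :: "(real \<Rightarrow> real) \<Rightarrow> (real \<Rightarrow> real) \<Rightarrow> real \<Rightarrow> real" where
  "mollify \<rho> f x = (LINT t|lborel. f t * \<rho> (x - t))"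

lemma test_fun_reflect: "test_fun \<rho> \<Longrightarrow> test_fun (\<lambda>t. \<rho> (x - t))"
  using test_fun_affine[of \<rho> "-1" 1 x] by simp

lemma integrable_mult_test_fun:
  assumes "continuous_on UNIV f" "test_fun \<phi>"
  shows "integrable lborel (\<lambda>x. f x * \<phi> x)"
proof -
  obtain R where R: "\<And>x. R < \<bar>x\<bar> \<Longrightarrow> \<phi> x = 0" using test_fun_support[OF assms(2)] by metis
  show ?thesis
    by (rule continuous_compact_support_integrable[where R=R])
       (use R in \<open>auto intro!: continuous_on_mult assms(1) test_fun_continuous[OF assms(2)]\<close>)
qed

lemma mollify_shift: "mollify \<rho> f x = (LINT t|lborel. f (x - t) * \<rho> t)"
  unfolding mollify_def
  using lborel_integral_real_affine[of "-1" "\<lambda>t. f t * \<rho> (x - t)" x] by simp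

lemma integrable_mollify:
  assumes "continuous_on UNIV f" "test_fun \<rho>"
  shows "integrable lborel (\<lambda>t. f (x - t) * \<rho> t)"
  by (rule integrable_mult_test_fun[OF _ assms(2)])
     (rule continuous_on_compose2[OF assms(1)], auto intro!: continuous_intros)

text \<open>Two functions and two base points cover both uses: a constant \<open>g\<close> measures
  the distance from \<open>mollify \<rho> f\<close> to \<open>f\<close>, and \<open>g = f\<close>
  transfers the modulus of continuity.\<close>

lemma mollify_diff_le:
  assumes f: "continuous_on UNIV f" and g: "continuous_on UNIV g" and \<rho>: "test_fun \<rho>" "\<And>x. 0 \<le> \<rho> x" "(LINT x|lborel. \<rho> x) = 1"
    and e: "\<And>t. \<rho> t \<noteq> 0 \<Longrightarrow> \<bar>f (x - t) - g (y - t)\<bar> \<le> e"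
  shows "\<bar>mollify \<rho> f x - mollify \<rho> g y\<bar> \<le> e"
proof -
  have "\<bar>mollify \<rho> f x - mollify \<rho> g y\<bar> = \<bar>LINT t|lborel. f (x - t) * \<rho> t - g (y - t) * \<rho> t\<bar>"
    unfolding mollify_shift by (subst Bochner_Integration.integral_diff) (auto intro!: integrable_mollify f g \<rho>)
  also have "\<dots> \<le> (LINT t|lborel. \<bar>f (x - t) * \<rho> t - g (y - t) * \<rho> t\<bar>)"
    by (rule integral_abs_bound)
  also have "\<dots> \<le> (LINT t|lborel. e * \<rho> t)"
  proof (intro integral_mono integrable_abs Bochner_Integration.integrable_diff integrable_mult_right integrable_mollify test_fun_integrable f g \<rho>(1))
    fix t
    show "\<bar>f (x - t) * \<rho> t - g (y - t) * \<rho> t\<bar> \<le> e * \<rho> t"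
      using mult_right_mono[OF e[of t] \<rho>(2)[of t]] \<rho>(2)[of t]
      by (cases "\<rho> t = 0") (simp_all add: abs_mult flip: left_diff_distrib)
  qed
  finally show ?thesis using \<rho>(3) by simp
qed

lemma mollify_const:
  assumes "(LINT x|lborel. \<rho> x) = 1" shows "mollify \<rho> (\<lambda>_. c) x = c"
  unfolding mollify_shift using assms by simp

lemma mollify_close:
  assumes f: "continuous_on UNIV f" and \<rho>: "test_fun \<rho>" "\<And>x. 0 \<le> \<rho> x" "(LINT x|lborel. \<rho> x) = 1"
    and r: "\<And>x. r \<le> \<bar>x\<bar> \<Longrightarrow> \<rho> x = 0" and e: "\<And>t. \<bar>t - x\<bar> < r \<Longrightarrow> \<bar>f t - f x\<bar> \<le> e"
  shows "\<bar>mollify \<rho> f x - f x\<bar> \<le> e"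
proof -
  have "\<bar>mollify \<rho> f x - mollify \<rho> (\<lambda>_. f x) x\<bar> \<le> e"
  proof (rule mollify_diff_le[OF f _ \<rho>])
    fix t assume "\<rho> t \<noteq> 0"
    with r[of t] have "\<bar>t\<bar> < r" by (meson not_le)
    then show "\<bar>f (x - t) - f x\<bar> \<le> e" by (intro e) auto
  qed simp
  then show ?thesis by (simp add: mollify_const \<rho>)
qed

lemma mollify_continuous:
  assumes f: "uniformly_continuous_on UNIV f" and \<rho>: "test_fun \<rho>" "\<And>x. 0 \<le> \<rho> x" "(LINT x|lborel. \<rho> x) = 1"
  shows "continuous_on UNIV (mollify \<rho> f)"
proof (rule uniformly_continuous_imp_continuous)
  show "uniformly_continuous_on UNIV (mollify \<rho> f)"
    unfolding uniformly_continuous_on_def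
  proof (intro allI impI)
    fix e :: real assume "e > 0"
    with f obtain d where d: "d > 0" "\<And>x y. dist x y < d \<Longrightarrow> dist (f x) (f y) < e / 2"
      unfolding uniformly_continuous_on_def by (metis UNIV_I half_gt_zero)
    have "dist (mollify \<rho> f x) (mollify \<rho> f y) < e" if "dist x y < d" for x y
    proof -
      have "\<bar>mollify \<rho> f x - mollify \<rho> f y\<bar> \<le> e / 2"
      proof (rule mollify_diff_le)
        fix t
        show "\<bar>f (x - t) - f (y - t)\<bar> \<le> e / 2"
          using d(2)[of "x - t" "y - t"] that by (simp add: dist_real_def less_imp_le)
      qed (use \<rho> f in \<open>auto intro: uniformly_continuous_imp_continuous\<close>)
      with \<open>e > 0\<close> show ?thesis by (simp add: dist_real_def)
    qed
    with d(1) show "\<exists>d>0. \<forall>x\<in>UNIV. \<forall>x'\<in>UNIV. dist x' x < d \<longrightarrow> dist (mollify \<rho> f x') (mollify \<rho> f x) < e"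
      by blast
  qed
qed

lemma continuous_has_antiderivative:
  fixes f :: "real \<Rightarrow> real"
  assumes "continuous_on UNIV f"
  obtains P where "\<And>x. (P has_real_derivative f x) (at x)"
proof
  fix x :: real
  define a where "a = min x 0 - 1"
  define b where "b = max x 0 + 1"
  have "((\<lambda>u. LBINT y=0..u. f y) has_vector_derivative f x) (at x within {a..b})"
    by (rule interval_integral_FTC2[where c=0, unfolded zero_ereal_def[symmetric]]) (use assms in \<open>auto simp: a_def b_def intro: continuous_on_subset\<close>)
  moreover have "at x within {a..b} = at x" by (rule at_within_Icc_at) (auto simp: a_def b_def)
  ultimately show "((\<lambda>u. LBINT y=0..u. f y) has_real_derivative f x) (at x)"
    by (simp add: has_real_derivative_iff_has_vector_derivative)
qed

text \<open>The weak derivative is tested with a smoothed indicator of \<open>[y, x]\<close>; the weight \<open>s\<close> comes from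
  splitting the resulting product by the inequality \<open>2 u v \<le> s u\<^sup>2 + v\<^sup>2 / s\<close>.\<close>

lemma H1_increment_bound:
  assumes f: "continuous_on UNIV f" and g: "L2 g" "weak_deriv f g" and "s > 0" "y \<le> x"
  shows "\<bar>f x - f y\<bar> \<le> (s * (LINT t|lborel. (g t)\<^sup>2) + (x - y) / s) / 2"
proof (rule field_le_epsilon)
  fix e :: real assume e: "e > 0"
  \<comment> \<open>Budget for e: two mollification errors of e / 4 each, and r / s <= e / 2 for
    widening the interval by r at both ends.\<close>
  define e' where "e' = min (e / 4) (e * s / 2)"
  have e': "e' > 0" using e \<open>s > 0\<close> by (simp add: e'_def)
  have "\<exists>d>0. \<forall>t. \<bar>t - z\<bar> < d \<longrightarrow> \<bar>f t - f z\<bar> < e'" for z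
    using f e' unfolding continuous_on_iff dist_real_def by auto
  then obtain d where d: "\<And>z. d z > 0" "\<And>z t. \<bar>t - z\<bar> < d z \<Longrightarrow> \<bar>f t - f z\<bar> < e'" by metis
  define r where "r = min (min (d x) (d y)) e'"
  have r: "r > 0" "r \<le> d x" "r \<le> d y" "r \<le> e'" using d e' by (auto simp: r_def)
  obtain \<rho> where \<rho>: "test_fun \<rho>" "\<And>x. 0 \<le> \<rho> x" "\<And>x. r \<le> \<bar>x\<bar> \<Longrightarrow> \<rho> x = 0" "(LINT x|lborel. \<rho> x) = 1"
    using mollifier_exists[OF r(1)] by metis
  have close: "\<bar>mollify \<rho> f z - f z\<bar> \<le> e'" if "r \<le> d z" for z
    using d(2)[of _ z] that by (intro mollify_close[OF f \<rho>(1,2,4,3)]) (auto intro: less_imp_le)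
  obtain P where P: "\<And>x. (P has_real_derivative \<rho> x) (at x)"
    using continuous_has_antiderivative[OF test_fun_continuous[OF \<rho>(1)]] by metis
  have mono: "P u \<le> P v" if "u \<le> v" for u v
    using DERIV_nonneg_imp_nondecreasing[OF that, of P] P \<rho>(2) by blast
  have const: "P u = P v" if "u \<le> v" "\<And>t. u \<le> t \<Longrightarrow> t \<le> v \<Longrightarrow> \<rho> t = 0" for u v
  proof (cases "u = v")
    case False
    with that P have "P v - P u = (v - u) * 0"
      by (metis MVT2 less_imp_le order_le_less)
    then show ?thesis by simp
  qed simp
  have up: "P u = P r" if "r \<le> u" for u
    using const[OF that] \<rho>(3) by auto
  have dn: "P u = P (-r)" if "u \<le> -r" for u
    using const[OF that] \<rho>(3) by auto
  have one: "P r - P (-r) = 1"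
  proof -
    have "(LINT t|lborel. \<rho> t * indicator {-r..r} t) = P r - P (-r)"
      by (rule integral_FTC_Icc_real)
         (use r P test_fun_continuous[OF \<rho>(1), of UNIV] in \<open>auto simp: continuous_on_eq_continuous_at\<close>)
    also have "(\<lambda>t. \<rho> t * indicator {-r..r} t) = \<rho>"
      using \<rho>(3) by (fastforce split: split_indicator)
    finally show ?thesis using \<rho>(4) by simp
  qed
  \<comment> \<open>Its derivative is a difference of two reflected mollifiers, so testing
    \<open>f\<close> against it yields the increment of \<open>mollify \<rho> f\<close> between x
    and y.\<close>
  define \<phi> where "\<phi> = (\<lambda>t. P (x - t) - P (y - t))"
  have \<phi>': "(\<phi> has_real_derivative \<rho> (y - t) - \<rho> (x - t)) (at t)" for t
    unfolding \<phi>_def by (rule derivative_eq_intros DERIV_chain2[OF P] refl)+ auto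
  have \<phi>b: "0 \<le> \<phi> t" "\<phi> t \<le> 1" for t
  proof -
    show "0 \<le> \<phi> t" using mono[of "y - t" "x - t"] \<open>y \<le> x\<close> by (simp add: \<phi>_def)
    have "P (x - t) \<le> P r" using mono[of "x - t" r] up[of "x - t"] by (cases "x - t \<le> r") auto
    moreover have "P (-r) \<le> P (y - t)" using mono[of "-r" "y - t"] dn[of "y - t"] by (cases "-r \<le> y - t") auto
    ultimately show "\<phi> t \<le> 1" using one by (simp add: \<phi>_def)
  qed
  have \<phi>0: "\<phi> t = 0" if t: "t \<notin> {y - r..x + r}" for t
  proof -
    consider "t < y - r" | "x + r < t" using t by (metis atLeastAtMost_iff not_le)
    then show ?thesis
    proof cases
      case 1
      then show ?thesis using up[of "x - t"] up[of "y - t"] \<open>y \<le> x\<close> by (simp add: \<phi>_def)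
    next
      case 2
      then show ?thesis using dn[of "x - t"] dn[of "y - t"] \<open>y \<le> x\<close> by (simp add: \<phi>_def)
    qed
  qed
  have "smooth_fun (\<lambda>t. \<rho> (y - t) - \<rho> (x - t))"
    using smooth_fun_add[OF smooth_fun_affine[of \<rho> 1 "-1" y] smooth_fun_affine[of \<rho> "-1" "-1" x]] \<rho>(1)
    by (simp add: test_fun_iff)
  then have "smooth_fun \<phi>" by (rule smooth_fun_antideriv[OF \<phi>'])
  moreover have "\<phi> t = 0" if "\<bar>x\<bar> + \<bar>y\<bar> + r < \<bar>t\<bar>" for t
    by (rule \<phi>0) (use that in auto)
  ultimately have \<phi>: "test_fun \<phi>" by (auto simp: test_fun_iff)
  have "deriv \<phi> = (\<lambda>t. \<rho> (y - t) - \<rho> (x - t))"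
    using \<phi>' by (auto intro!: DERIV_imp_deriv)
  moreover have "(LINT t|lborel. f t * deriv \<phi> t) = - (LINT t|lborel. g t * \<phi> t)"
    using g(2) \<phi> unfolding weak_deriv_def by blast
  ultimately have "- (LINT t|lborel. g t * \<phi> t) = (LINT t|lborel. f t * (\<rho> (y - t) - \<rho> (x - t)))"
    by simp
  also have "\<dots> = mollify \<rho> f y - mollify \<rho> f x"
    unfolding mollify_def right_diff_distrib
    by (rule Bochner_Integration.integral_diff) (intro integrable_mult_test_fun f test_fun_reflect \<rho>(1))+
  finally have mg: "\<bar>mollify \<rho> f x - mollify \<rho> f y\<bar> = \<bar>LINT t|lborel. g t * \<phi> t\<bar>" by linarith
  have ig: "integrable lborel (\<lambda>t. (g t)\<^sup>2)" using g(1) by (simp add: L2_def)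
  let ?A = "{y - r..x + r}"
  have ii: "integrable lborel (\<lambda>t. (s * (g t)\<^sup>2 + indicator ?A t / s) / 2)"
    by (intro integrable_divide Bochner_Integration.integrable_add integrable_mult_right ig integrable_real_indicator)
       (use r \<open>y \<le> x\<close> in auto)
  have "\<bar>LINT t|lborel. g t * \<phi> t\<bar> \<le> (LINT t|lborel. \<bar>g t * \<phi> t\<bar>)"
    by (rule integral_abs_bound)
  also have "\<dots> \<le> (LINT t|lborel. (s * (g t)\<^sup>2 + indicator ?A t / s) / 2)"
  proof (rule integral_mono'[OF ii])
    fix t
    have "0 \<le> (s * \<bar>g t\<bar> - \<bar>\<phi> t\<bar>)\<^sup>2" by simp
    then have "2 * (s * \<bar>g t\<bar> * \<bar>\<phi> t\<bar>) \<le> (s * \<bar>g t\<bar>)\<^sup>2 + \<bar>\<phi> t\<bar>\<^sup>2" by (simp add: power2_diff)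
    also have "\<dots> \<le> (s * \<bar>g t\<bar>)\<^sup>2 + indicator ?A t"
      using \<phi>b[of t] \<phi>0[of t] by (auto split: split_indicator simp: power_le_one)
    finally show "\<bar>g t * \<phi> t\<bar> \<le> (s * (g t)\<^sup>2 + indicator ?A t / s) / 2"
      using \<open>s > 0\<close> by (simp add: abs_mult field_simps power2_eq_square)
    show "0 \<le> (s * (g t)\<^sup>2 + indicator ?A t / s) / 2" using \<open>s > 0\<close> by simp
  qed
  also have "\<dots> = (s * (LINT t|lborel. (g t)\<^sup>2) + (x - y + 2 * r) / s) / 2"
    using ig r \<open>y \<le> x\<close> by simp
  also have "\<dots> = (s * (LINT t|lborel. (g t)\<^sup>2) + (x - y) / s) / 2 + r / s"
    by (simp add: add_divide_distrib)
  finally have "\<bar>mollify \<rho> f x - mollify \<rho> f y\<bar> \<le> (s * (LINT t|lborel. (g t)\<^sup>2) + (x - y) / s) / 2 + r / s"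
    unfolding mg .
  moreover have "r / s \<le> e / 2" using r(4) \<open>s > 0\<close> by (simp add: e'_def field_simps)
  moreover have "e' \<le> e / 4" by (simp add: e'_def)
  ultimately show "\<bar>f x - f y\<bar> \<le> (s * (LINT t|lborel. (g t)\<^sup>2) + (x - y) / s) / 2 + e"
    using close[OF r(2)] close[OF r(3)] by linarith
qed

lemma H1_uniformly_continuous:
  assumes "H1 f" "continuous_on UNIV f"
  shows "uniformly_continuous_on UNIV f"
  unfolding uniformly_continuous_on_def
proof (intro allI impI)
  fix e :: real assume e: "e > 0"
  obtain g where g: "L2 g" "weak_deriv f g" using assms(1) by (auto simp: H1_def)
  define G where "G = (LINT t|lborel. (g t)\<^sup>2)"
  have G: "0 \<le> G" unfolding G_def by (intro Bochner_Integration.integral_nonneg) auto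
  \<comment> \<open>The weight gives the \<open>G\<close> term at most e / 2, and x - y < e s gives
    the length term less than e / 2; the added 1 covers G = 0.\<close>
  define s where "s = e / (G + 1)"
  have s: "s > 0" "s * G \<le> e" using G e by (auto simp: s_def field_simps)
  have *: "\<bar>f x - f y\<bar> < e" if "x - y < e * s" "y \<le> x" for x y
  proof -
    have "(x - y) / s < e" using that s by (simp add: field_simps)
    then show ?thesis
      using H1_increment_bound[OF assms(2) g s(1) that(2)] s(2) by (simp add: G_def)
  qed
  have "dist (f x') (f x) < e" if "dist x' x < e * s" for x x'
    using *[of x x'] *[of x' x] that by (cases "x \<le> x'") (auto simp: dist_real_def abs_minus_commute)
  moreover have "e * s > 0" using e s by simp
  ultimately show "\<exists>d>0. \<forall>x\<in>UNIV. \<forall>x'\<in>UNIV. dist x' x < d \<longrightarrow> dist (f x') (f x) < e" by blast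
qed

text \<open>By uniform continuity, a value of size e at a far point forces size e / 2 on an interval
  of fixed length, and the square mass there exceeds the tail of the convergent integral.\<close>

lemma H1_tendsto_0:
  assumes "H1 f" "continuous_on UNIV f"
  shows "(f \<longlongrightarrow> 0) at_infinity"
  unfolding tendsto_iff eventually_at_infinity
proof (intro allI impI)
  fix e :: real assume e: "e > 0"
  obtain d where d: "d > 0" "\<And>x y. dist x y < d \<Longrightarrow> dist (f x) (f y) < e / 2"
    using H1_uniformly_continuous[OF assms] e unfolding uniformly_continuous_on_def by (metis UNIV_I half_gt_zero)
  have i: "integrable lborel (\<lambda>t. (f t)\<^sup>2)" and [measurable]: "f \<in> borel_measurable borel"
    using assms(1) by (auto simp: H1_def L2_def)
  have "(\<lambda>n. LINT t|lborel. (f t)\<^sup>2 * indicator {t. real n < \<bar>t\<bar>} t) \<longlonglongrightarrow> integral\<^sup>L lborel (\<lambda>t::real. 0)"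
  proof (rule integral_dominated_convergence)
    show "integrable lborel (\<lambda>t. (f t)\<^sup>2)" by (rule i)
    show "AE t in lborel. (\<lambda>n. (f t)\<^sup>2 * indicator {t. real n < \<bar>t\<bar>} t) \<longlonglongrightarrow> 0"
    proof (intro always_eventually allI)
      fix t
      obtain N where "\<bar>t\<bar> \<le> real N" using real_arch_simple by blast
      then have "\<forall>\<^sub>F n in sequentially. (f t)\<^sup>2 * indicator {t. real n < \<bar>t\<bar>} t = 0"
        by (intro eventually_sequentiallyI[of N]) auto
      then show "(\<lambda>n. (f t)\<^sup>2 * indicator {t. real n < \<bar>t\<bar>} t) \<longlonglongrightarrow> 0"
        by (rule tendsto_eventually)
    qed
  qed (auto split: split_indicator)
  moreover have "integral\<^sup>L lborel (\<lambda>t::real. 0) < d / 2 * (e / 2)\<^sup>2" using d e by simp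
  ultimately have "\<forall>\<^sub>F n in sequentially. (LINT t|lborel. (f t)\<^sup>2 * indicator {t. real n < \<bar>t\<bar>} t) < d / 2 * (e / 2)\<^sup>2"
    by (rule order_tendstoD(2))
  then obtain n where n: "(LINT t|lborel. (f t)\<^sup>2 * indicator {t. real n < \<bar>t\<bar>} t) < d / 2 * (e / 2)\<^sup>2"
    by (auto simp: eventually_sequentially)
  \<comment> \<open>The extra d keeps the interval from x to x + d / 2 outside |t| <= n also for
    negative x, where it points towards the origin.\<close>
  have "dist (f x) 0 < e" if x: "real n + d \<le> norm x" for x
  proof (rule ccontr)
    assume "\<not> dist (f x) 0 < e"
    then have fx: "e \<le> \<bar>f x\<bar>" by simp
    have "(LINT t|lborel. (e / 2)\<^sup>2 * indicator {x..x + d / 2} t) \<le> (LINT t|lborel. (f t)\<^sup>2 * indicator {t. real n < \<bar>t\<bar>} t)"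
    proof (rule integral_mono)
      show "integrable lborel (\<lambda>t. (f t)\<^sup>2 * indicator {t. real n < \<bar>t\<bar>} t)"
        by (rule Bochner_Integration.integrable_bound[OF i]) (auto split: split_indicator)
      show "integrable lborel (\<lambda>t. (e / 2)\<^sup>2 * indicator {x..x + d / 2} t)"
        by (intro integrable_mult_right integrable_real_indicator) (use d(1) in auto)
      fix t
      show "(e / 2)\<^sup>2 * indicator {x..x + d / 2} t \<le> (f t)\<^sup>2 * indicator {t. real n < \<bar>t\<bar>} t"
      proof (cases "t \<in> {x..x + d / 2}")
        case True
        then have "\<bar>f x - f t\<bar> < e / 2" using d(2)[of x t] d(1) by (simp add: dist_real_def)
        with fx have "\<bar>e / 2\<bar> \<le> \<bar>f t\<bar>" using e by linarith
        then have "(e / 2)\<^sup>2 \<le> (f t)\<^sup>2" by (simp only: abs_le_square_iff)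
        moreover have "real n < \<bar>t\<bar>" using True x d(1) by auto
        ultimately show ?thesis using True by simp
      qed simp
    qed
    moreover have "(LINT t|lborel. (e / 2)\<^sup>2 * indicator {x..x + d / 2} t) = d / 2 * (e / 2)\<^sup>2"
      using d(1) by simp
    ultimately show False using n by linarith
  qed
  then show "\<exists>b. \<forall>x. b \<le> norm x \<longrightarrow> dist (f x) 0 < e" by blast
qed

section \<open>Maximum principle and exponential decay\<close>

lemma uniformly_continuous_if_tendsto_0:
  fixes f :: "real \<Rightarrow> real"
  assumes f: "continuous_on UNIV f" "(f \<longlongrightarrow> 0) at_infinity"
  shows "uniformly_continuous_on UNIV f"
  unfolding uniformly_continuous_on_def
proof (intro allI impI)
  fix e :: real assume e: "e > 0"
  then obtain b where b: "\<And>x. b \<le> \<bar>x\<bar> \<Longrightarrow> \<bar>f x\<bar> < e / 2"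
    using tendstoD[OF f(2), of "e / 2"] unfolding eventually_at_infinity by auto
  have "uniformly_continuous_on {-b - 1..b + 1} f"
    by (intro compact_uniformly_continuous continuous_on_subset[OF f(1)]) auto
  then obtain d where d: "d > 0" "\<And>x y. x \<in> {-b - 1..b + 1} \<Longrightarrow> y \<in> {-b - 1..b + 1} \<Longrightarrow> dist y x < d \<Longrightarrow> dist (f y) (f x) < e"
    using e unfolding uniformly_continuous_on_def by metis
  have "dist (f y) (f x) < e" if xy: "dist y x < min d 1" for x y
  proof (cases "x \<in> {-b - 1..b + 1} \<and> y \<in> {-b - 1..b + 1}")
    case True
    with d xy show ?thesis by simp
  next
    case False
    with xy have "b \<le> \<bar>x\<bar>" "b \<le> \<bar>y\<bar>" by (auto simp: dist_real_def abs_if split: if_splits)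
    with b[of x] b[of y] show ?thesis by (simp add: dist_real_def)
  qed
  with d(1) show "\<exists>d>0. \<forall>x\<in>UNIV. \<forall>x'\<in>UNIV. dist x' x < d \<longrightarrow> dist (f x') (f x) < e"
    by (intro exI[of _ "min d 1"]) auto
qed

lemma bounded_if_tendsto_0:
  fixes f :: "real \<Rightarrow> real"
  assumes f: "continuous_on UNIV f" "(f \<longlongrightarrow> 0) at_infinity"
  obtains B where "B > 0" "\<And>x. \<bar>f x\<bar> \<le> B"
proof -
  obtain b where b: "\<And>x. b \<le> \<bar>x\<bar> \<Longrightarrow> \<bar>f x\<bar> < 1"
    using tendstoD[OF f(2), of 1] unfolding eventually_at_infinity by auto
  have "bounded (f ` {-b..b})"
    by (intro compact_imp_bounded compact_continuous_image continuous_on_subset[OF f(1)]) auto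
  then obtain B where B: "B > 0" "\<And>x. x \<in> {-b..b} \<Longrightarrow> \<bar>f x\<bar> \<le> B"
    unfolding bounded_pos by auto
  have "\<bar>f x\<bar> \<le> max B 1" for x
  proof (cases "b \<le> \<bar>x\<bar>")
    case True
    with b[of x] show ?thesis by simp
  next
    case False
    then have "x \<in> {-b..b}" by auto
    with B(2)[of x] show ?thesis by simp
  qed
  then show thesis using that[of "max B 1"] by simp
qed

text \<open>Transfers K from the reflected mollifier to the mollified function: integrating
  \<open>w\<close> against second differences of \<open>\<phi>\<close> gives second differences of
  \<open>m\<close>, once Fubini is justified.\<close>

lemma mollify_kcoth:
  assumes w: "continuous_on UNIV w" "\<And>x. \<bar>w x\<bar> \<le> B" and \<rho>: "test_fun \<rho>" and h: "h > 0"
  defines "m \<equiv> mollify \<rho> w"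
  shows "integrable lborel (\<lambda>x. w x * fmult (kcoth h) (\<lambda>t. \<rho> (x0 - t)) x)"
    and "integrable lborel (\<lambda>y. (2 * m x0 - m (x0 + y) - m (x0 - y)) * coth_kernel h y)"
    and "(LINT x|lborel. w x * fmult (kcoth h) (\<lambda>t. \<rho> (x0 - t)) x) =
         m x0 / h + (LINT y|lborel. (2 * m x0 - m (x0 + y) - m (x0 - y)) * coth_kernel h y) / 2"
proof -
  define \<phi> where "\<phi> = (\<lambda>t. \<rho> (x0 - t))"
  have \<phi>: "test_fun \<phi>" unfolding \<phi>_def by (rule test_fun_reflect[OF \<rho>])
  have [measurable]: "\<phi> \<in> borel_measurable borel" "w \<in> borel_measurable borel"
    by (intro test_fun_measurable \<phi> borel_measurable_continuous_onI w(1))+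
  obtain R where R: "R > 0" "\<And>x. R < \<bar>x\<bar> \<Longrightarrow> \<phi> x = 0" using test_fun_support[OF \<phi>] by metis
  obtain M where M: "M > 0" "\<And>x y. \<bar>2 * \<phi> x - \<phi> (x + y) - \<phi> (x - y)\<bar> \<le> M * y\<^sup>2"
    using test_fun_second_difference[OF \<phi>] by metis
  define D where "D = (\<lambda>x y. (2 * \<phi> x - \<phi> (x + y) - \<phi> (x - y)) * coth_kernel h y)"
  define b where "b = pi / (4 * h)"
  have b: "b > 0" using h by (simp add: b_def)
  have B: "0 \<le> B" using w(2)[of 0] by linarith
  define F where "F = (\<lambda>(x, y). w x * D x y)"
  have Fm: "F \<in> borel_measurable (lborel \<Otimes>\<^sub>M lborel)" unfolding F_def D_def by measurable
  have Fi: "integrable (lborel \<Otimes>\<^sub>M lborel) F"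
  proof (rule lborel_pair_integrable_bound[OF Fm integrable_mult_right[OF integrable_exp_abs[OF b], of "2 * B * M * exp (b * R)"] integrable_exp_abs[OF b]])
    fix x y
    have "\<bar>D x y\<bar> \<le> 2 * M * exp (b * R) * exp (- b * \<bar>x\<bar>) * exp (- b * \<bar>y\<bar>)"
    \<comment> \<open>Beyond |x| = R + |y| all three values of \<open>\<phi>\<close> vanish. Within
      it, half of the decay in y can be traded for decay in x, which gives the product
      bound.\<close>
    proof (cases "\<bar>x\<bar> \<le> R + \<bar>y\<bar>")
      case True
      have "\<bar>D x y\<bar> \<le> M * y\<^sup>2 * coth_kernel h y"
        unfolding D_def abs_mult abs_of_nonneg[OF coth_kernel_nonneg] by (intro mult_right_mono M coth_kernel_nonneg)
      also have "\<dots> = M * (y\<^sup>2 * coth_kernel h y)" by simp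
      also have "\<dots> \<le> M * (2 * exp (- (pi / (2 * h)) * \<bar>y\<bar>))"
        using M(1) by (intro mult_left_mono coth_kernel_bound h) auto
      also have "- (pi / (2 * h)) = - b - b" using h by (simp add: b_def field_simps)
      also have "M * (2 * exp ((- b - b) * \<bar>y\<bar>)) \<le> M * (2 * exp (b * R + - b * \<bar>x\<bar> + - b * \<bar>y\<bar>))"
      proof -
        have "b * \<bar>x\<bar> \<le> b * (R + \<bar>y\<bar>)" using True b by (intro mult_left_mono) auto
        then show ?thesis using M(1) by (intro mult_left_mono) (auto simp: algebra_simps)
      qed
      finally show ?thesis by (simp only: exp_add mult_ac)
    next
      case False
      then have "D x y = 0" using R(1) R(2)[of x] R(2)[of "x + y"] R(2)[of "x - y"] by (simp add: D_def)
      with M(1) show ?thesis by simp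
    qed
    then have "\<bar>w x\<bar> * \<bar>D x y\<bar> \<le> B * (2 * M * exp (b * R) * exp (- b * \<bar>x\<bar>) * exp (- b * \<bar>y\<bar>))"
      using B by (intro mult_mono w) auto
    then show "norm (F (x, y)) \<le> 2 * B * M * exp (b * R) * exp (- b * \<bar>x\<bar>) * exp (- b * \<bar>y\<bar>)"
      by (simp add: F_def abs_mult mult_ac)
  qed
  have wi: "integrable lborel (\<lambda>t. w t * \<phi> (t + y))" for y
  proof -
    have "\<phi> (t + y) = \<rho> ((x0 - y) - t)" for t by (simp add: \<phi>_def algebra_simps)
    then show ?thesis using integrable_mult_test_fun[OF w(1) test_fun_reflect[OF \<rho>, of "x0 - y"]] by simp
  qed
  have m: "(LINT t|lborel. w t * \<phi> (t + y)) = m (x0 - y)" for y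
    by (simp add: m_def mollify_def \<phi>_def algebra_simps)
  have Fy: "(LINT x|lborel. F (x, y)) = (2 * m x0 - m (x0 + y) - m (x0 - y)) * coth_kernel h y" for y
  proof -
    have "(LINT x|lborel. F (x, y)) =
        (LINT x|lborel. (2 * (w x * \<phi> (x + 0)) - w x * \<phi> (x + y) - w x * \<phi> (x + - y)) * coth_kernel h y)"
      by (simp add: F_def D_def algebra_simps)
    also have "\<dots> = (2 * (LINT x|lborel. w x * \<phi> (x + 0)) - (LINT x|lborel. w x * \<phi> (x + y)) - (LINT x|lborel. w x * \<phi> (x + - y))) * coth_kernel h y"
      using wi by (simp del: add_0_right add_uminus_conv_diff)
    finally show ?thesis by (simp only: m) (simp add: diff_right_commute)
  qed
  have Fi': "integrable (lborel \<Otimes>\<^sub>M lborel) (case_prod (\<lambda>x y. F (x, y)))" using Fi by simp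
  show "integrable lborel (\<lambda>y. (2 * m x0 - m (x0 + y) - m (x0 - y)) * coth_kernel h y)"
    using lborel_pair.integrable_snd[OF Fi'] by (simp add: Fy)
  have wf: "w x * fmult (kcoth h) \<phi> x = w x * \<phi> (x + 0) / h + (LINT y|lborel. F (x, y)) / 2" for x
  proof -
    have "fmult (kcoth h) \<phi> x = \<phi> x / h + (LINT y|lborel. D x y) / 2"
      unfolding D_def by (rule fmult_kcoth[OF \<phi> h])
    then show ?thesis by (simp add: F_def distrib_left)
  qed
  have Fx: "integrable lborel (\<lambda>x. LINT y|lborel. F (x, y))"
    using lborel_pair.integrable_fst[OF Fi'] .
  have "integrable lborel (\<lambda>x. w x * fmult (kcoth h) \<phi> x)"
    unfolding wf by (intro Bochner_Integration.integrable_add integrable_divide wi Fx)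
  then show "integrable lborel (\<lambda>x. w x * fmult (kcoth h) (\<lambda>t. \<rho> (x0 - t)) x)" by (simp add: \<phi>_def)
  have "(LINT x|lborel. w x * fmult (kcoth h) \<phi> x) = m x0 / h + (LINT x|lborel. LINT y|lborel. F (x, y)) / 2"
    unfolding wf using wi[of 0] Fx m[of 0] by simp
  also have "(LINT x|lborel. LINT y|lborel. F (x, y)) = (LINT y|lborel. LINT x|lborel. F (x, y))"
    using lborel_pair.Fubini_integral[OF Fi'] by simp
  finally show "(LINT x|lborel. w x * fmult (kcoth h) (\<lambda>t. \<rho> (x0 - t)) x) =
         m x0 / h + (LINT y|lborel. (2 * m x0 - m (x0 + y) - m (x0 - y)) * coth_kernel h y) / 2"
    by (simp add: Fy \<phi>_def)
qed

text \<open>For x >= 0 one has |x + y| >= |x| + y and |x - y| >= |x| - y, with the roles exchanged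
  for x < 0. Thus the kink at 0 only lowers the left side, and the barrier needs no
  smoothing.\<close>

lemma exp_abs_even_shift_le:
  fixes \<eta> :: real
  assumes "0 \<le> \<eta>"
  shows "exp (- \<eta> * \<bar>x + y\<bar>) + exp (- \<eta> * \<bar>x - y\<bar>) \<le> 2 * exp (- \<eta> * \<bar>x\<bar>) * cosh (\<eta> * y)"
proof -
  have *: "exp (- \<eta> * \<bar>u\<bar>) \<le> exp (- \<eta> * \<bar>x\<bar>) * exp (- (\<eta> * v))" if "\<bar>x\<bar> + v \<le> \<bar>u\<bar>" for u v
    using mult_left_mono[OF that assms] by (simp add: algebra_simps flip: exp_add)
  have "exp (- \<eta> * \<bar>x + y\<bar>) + exp (- \<eta> * \<bar>x - y\<bar>) \<le> exp (- \<eta> * \<bar>x\<bar>) * exp (- (\<eta> * y)) + exp (- \<eta> * \<bar>x\<bar>) * exp (- (\<eta> * (- y)))"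
  proof (cases "0 \<le> x")
    case True
    then show ?thesis by (intro add_mono *) auto
  next
    case False
    then have "exp (- \<eta> * \<bar>x + y\<bar>) + exp (- \<eta> * \<bar>x - y\<bar>) \<le> exp (- \<eta> * \<bar>x\<bar>) * exp (- (\<eta> * (- y))) + exp (- \<eta> * \<bar>x\<bar>) * exp (- (\<eta> * y))"
      by (intro add_mono *) auto
    then show ?thesis by simp
  qed
  then show ?thesis by (simp add: cosh_def algebra_simps)
qed

text \<open>At a maximum of (mollified \<open>w\<close>) \<open>- \<Phi>\<close> the second differences of \<open>w\<close> dominate those of
  \<open>\<Phi> = N exp (- \<eta> \<bar>x\<bar>)\<close>, which the smallness of the exponential moment controls by \<open>\<Phi> / h\<close>.
  Mollifying makes the equation hold pointwise, at the cost of an error \<open>e\<close>.\<close>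

lemma kcoth_comparison:
  fixes h l \<eta> N R :: real
  assumes h: "h > 0" and l: "l > 0"
    and \<eta>: "\<eta> > 0" "integrable lborel (\<lambda>y. (cosh (\<eta> * y) - 1) * coth_kernel h y)"
      "(LINT y|lborel. (cosh (\<eta> * y) - 1) * coth_kernel h y) \<le> 1 / h"
    and w: "continuous_on UNIV w" "(w \<longlongrightarrow> 0) at_infinity"
    and f: "continuous_on UNIV f" "(f \<longlongrightarrow> 0) at_infinity"
    and eq: "\<And>\<phi>. test_fun \<phi> \<Longrightarrow> (LINT x|lborel. w x * fmult (kcoth h) \<phi> x + l * (w x * \<phi> x)) = (LINT x|lborel. f x * \<phi> x)"
    and out: "\<And>x. R < \<bar>x\<bar> \<Longrightarrow> \<bar>f x\<bar> \<le> l / 2 * \<bar>w x\<bar>"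
    and N: "N > 0" and inn: "\<And>x. \<bar>x\<bar> \<le> R \<Longrightarrow> w x \<le> N * exp (- \<eta> * \<bar>x\<bar>)"
  shows "w x \<le> N * exp (- \<eta> * \<bar>x\<bar>)"
proof (rule field_le_epsilon)
  fix e0 :: real assume e0: "e0 > 0"
  \<comment> \<open>The estimate for m costs (1 + 2 / l) e, and returning from m to w at x costs one
    more e.\<close>
  define e where "e = e0 / (2 + 2 / l)"
  have K: "0 < 2 + 2 / l" using l by (simp add: add_pos_pos)
  have e: "e > 0" "(2 + 2 / l) * e = e0" using e0 K by (auto simp: e_def)
  note ucw = uniformly_continuous_if_tendsto_0[OF w] and ucf = uniformly_continuous_if_tendsto_0[OF f]
  obtain B where B: "\<And>x. \<bar>w x\<bar> \<le> B" using bounded_if_tendsto_0[OF w] by metis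
  obtain r1 where r1: "r1 > 0" "\<And>s t. dist s t < r1 \<Longrightarrow> dist (w s) (w t) < e"
    using ucw e unfolding uniformly_continuous_on_def by (metis UNIV_I)
  obtain r2 where r2: "r2 > 0" "\<And>s t. dist s t < r2 \<Longrightarrow> dist (f s) (f t) < e"
    using ucf e unfolding uniformly_continuous_on_def by (metis UNIV_I)
  obtain \<rho> where \<rho>: "test_fun \<rho>" "\<And>x. 0 \<le> \<rho> x" "(LINT x|lborel. \<rho> x) = 1" "\<And>x. min r1 r2 \<le> \<bar>x\<bar> \<Longrightarrow> \<rho> x = 0"
    using mollifier_exists[of "min r1 r2"] r1(1) r2(1) by (metis min_less_iff_conj)
  define m where "m = mollify \<rho> w"
  have mw: "\<bar>m z - w z\<bar> \<le> e" for z
    unfolding m_def by (rule mollify_close[OF w(1) \<rho>]) (use r1(2) in \<open>auto simp: dist_real_def less_imp_le\<close>)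
  have nf: "\<bar>mollify \<rho> f z - f z\<bar> \<le> e" for z
    by (rule mollify_close[OF f(1) \<rho>]) (use r2(2) in \<open>auto simp: dist_real_def less_imp_le\<close>)
  define \<Phi> where "\<Phi> = (\<lambda>x. N * exp (- \<eta> * \<bar>x\<bar>))"
  have \<Phi>pos: "0 < \<Phi> z" for z using N by (simp add: \<Phi>_def)
  have "m x - \<Phi> x \<le> (1 + 2 / l) * e"
  proof (cases "m x - \<Phi> x \<le> e")
    case True
    have "0 < 2 / l * e" using l e by simp
    with True show ?thesis by (simp add: distrib_right)
  next
    case False
    \<comment> \<open>Beyond S even w + e stays below the excess at x, so the supremum of m - \<Phi>
      over the line is attained on a compact interval containing x.\<close>
    then obtain S where S: "\<And>z. S \<le> \<bar>z\<bar> \<Longrightarrow> \<bar>w z\<bar> < m x - \<Phi> x - e"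
      using tendstoD[OF w(2), of "m x - \<Phi> x - e"] unfolding eventually_at_infinity by auto
    have "continuous_on {-max S \<bar>x\<bar>..max S \<bar>x\<bar>} (\<lambda>z. m z - \<Phi> z)"
      unfolding \<Phi>_def m_def
      by (intro continuous_intros continuous_on_subset[OF mollify_continuous[OF ucw \<rho>(1-3)]]) auto
    moreover have "x \<in> {-max S \<bar>x\<bar>..max S \<bar>x\<bar>}" by (auto simp: max_def)
    ultimately obtain x0 where "\<forall>z\<in>{-max S \<bar>x\<bar>..max S \<bar>x\<bar>}. m z - \<Phi> z \<le> m x0 - \<Phi> x0"
      using continuous_attains_sup[of "{-max S \<bar>x\<bar>..max S \<bar>x\<bar>}" "\<lambda>z. m z - \<Phi> z"] by blast
    then have x0: "m z - \<Phi> z \<le> m x0 - \<Phi> x0" if "\<bar>z\<bar> \<le> max S \<bar>x\<bar>" for z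
      using that by (simp add: abs_le_iff)
    have max: "m z - \<Phi> z \<le> m x0 - \<Phi> x0" for z
    proof (cases "\<bar>z\<bar> \<le> max S \<bar>x\<bar>")
      case False
      then have "\<bar>w z\<bar> < m x - \<Phi> x - e" by (intro S) auto
      then have "m z - \<Phi> z \<le> m x - \<Phi> x" using mw[of z] \<Phi>pos[of z] by linarith
      also have "\<dots> \<le> m x0 - \<Phi> x0" by (rule x0) simp
      finally show ?thesis .
    qed (rule x0)
    have pos: "\<Phi> x0 + e < m x0" using False max[of x] by linarith
    \<comment> \<open>Inside the ball w <= \<Phi>, so m could exceed \<Phi> there by at most e, less
      than its excess at the maximum.\<close>
    have "R < \<bar>x0\<bar>"
    proof (rule ccontr)
      assume "\<not> R < \<bar>x0\<bar>"
      then have "w x0 \<le> \<Phi> x0" unfolding \<Phi>_def by (intro inn) auto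
      with mw[of x0] pos show False by linarith
    qed
    have dd: "- (2 * \<Phi> x0 * ((cosh (\<eta> * y) - 1) * coth_kernel h y)) \<le> (2 * m x0 - m (x0 + y) - m (x0 - y)) * coth_kernel h y" for y
    proof -
      have "N * (exp (- \<eta> * \<bar>x0 + y\<bar>) + exp (- \<eta> * \<bar>x0 - y\<bar>)) \<le> N * (2 * exp (- \<eta> * \<bar>x0\<bar>) * cosh (\<eta> * y))"
        using N \<eta>(1) by (intro mult_left_mono exp_abs_even_shift_le) auto
      then have "\<Phi> (x0 + y) + \<Phi> (x0 - y) \<le> 2 * \<Phi> x0 * cosh (\<eta> * y)"
        by (simp add: \<Phi>_def algebra_simps)
      then have "- (2 * \<Phi> x0 * (cosh (\<eta> * y) - 1)) \<le> 2 * m x0 - m (x0 + y) - m (x0 - y)"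
        using max[of "x0 + y"] max[of "x0 - y"] by (simp add: right_diff_distrib)
      from mult_right_mono[OF this coth_kernel_nonneg[of h y]] show ?thesis by (simp add: mult_ac)
    qed
    note mk = mollify_kcoth[OF w(1) B \<rho>(1) h, of x0, folded m_def]
    have "2 * \<Phi> x0 * (LINT y|lborel. (cosh (\<eta> * y) - 1) * coth_kernel h y) \<le> 2 * \<Phi> x0 * (1 / h)"
      using \<Phi>pos[of x0] by (intro mult_left_mono \<eta>(3)) auto
    then have "- (2 * \<Phi> x0 * (1 / h)) \<le> (LINT y|lborel. - (2 * \<Phi> x0 * ((cosh (\<eta> * y) - 1) * coth_kernel h y)))"
      by simp
    also have "\<dots> \<le> (LINT y|lborel. (2 * m x0 - m (x0 + y) - m (x0 - y)) * coth_kernel h y)"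
      using \<eta>(2) by (intro integral_mono dd mk(2)) auto
    finally have I: "- (2 * \<Phi> x0 * (1 / h)) \<le> (LINT y|lborel. (2 * m x0 - m (x0 + y) - m (x0 - y)) * coth_kernel h y)" (is "_ \<le> ?I") .
    have t: "test_fun (\<lambda>t. \<rho> (x0 - t))" by (rule test_fun_reflect[OF \<rho>(1)])
    \<comment> \<open>Testing with the reflected mollifier centred at x0 turns the weak equation
      into a pointwise one at the maximum.\<close>
    have "m x0 / h + ?I / 2 + l * m x0 = mollify \<rho> f x0"
      using eq[OF t] mk(1) integrable_mult_test_fun[OF w(1) t]
      by (simp add: mk(3) m_def mollify_def)
    also have "\<dots> \<le> \<bar>f x0\<bar> + e" using nf[of x0] by linarith
    also have "\<dots> \<le> l / 2 * \<bar>w x0\<bar> + e" using out[OF \<open>R < \<bar>x0\<bar>\<close>] by simp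
    also have "\<dots> \<le> l / 2 * (m x0 + e) + e"
      using mw[of x0] pos \<Phi>pos[of x0] l by (intro add_right_mono mult_left_mono) auto
    finally have II: "m x0 / h + ?I / 2 + l * m x0 \<le> l / 2 * (m x0 + e) + e" .
    \<comment> \<open>Here a, b, i are the mollified value, the barrier and the jump integral at x0.
      The lower bound on i costs at most b / h, paid by a / h since a > b. Half of l a absorbs the
      right-hand side, and the other half then bounds a by a multiple of e.\<close>
    have "(a - b) / h + l / 2 * a \<le> (1 + l / 2) * e"
      if "- (2 * b * (1 / h)) \<le> i" "a / h + i / 2 + l * a \<le> l / 2 * (a + e) + e" for a b i
    proof -
      have "2 * b * (1 / h) = 2 * (b / h)" "(a - b) / h = a / h - b / h" by (simp_all add: diff_divide_distrib)
      with that show ?thesis unfolding distrib_left distrib_right by linarith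
    qed
    from this[OF I II] have "(m x0 - \<Phi> x0) / h + l / 2 * m x0 \<le> (1 + l / 2) * e" .
    moreover have "0 \<le> (m x0 - \<Phi> x0) / h" using pos e h by simp
    ultimately have "l / 2 * m x0 \<le> (1 + l / 2) * e" by linarith
    then have "m x0 \<le> (1 + 2 / l) * e" using l by (simp add: field_simps)
    then show ?thesis using max[of x] \<Phi>pos[of x0] by linarith
  qed
  then show "w x \<le> N * exp (- \<eta> * \<bar>x\<bar>) + e0"
    using mw[of x] e(2) by (simp add: \<Phi>_def algebra_simps)
qed

text \<open>The comparison is one-sided; the equation is linear in the pair (w, f), so applying it
  also to (- w, - f) gives the bound on the absolute value.\<close>

theorem kcoth_exponential_decay:
  fixes h l R :: real
  assumes h: "h > 0" and l: "l > 0"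
    and w: "continuous_on UNIV w" "(w \<longlongrightarrow> 0) at_infinity"
    and f: "continuous_on UNIV f" "(f \<longlongrightarrow> 0) at_infinity"
    and eq: "\<And>\<phi>. test_fun \<phi> \<Longrightarrow> (LINT x|lborel. w x * fmult (kcoth h) \<phi> x + l * (w x * \<phi> x)) = (LINT x|lborel. f x * \<phi> x)"
    and out: "\<And>x. R < \<bar>x\<bar> \<Longrightarrow> \<bar>f x\<bar> \<le> l / 2 * \<bar>w x\<bar>"
  obtains \<eta> N where "\<eta> > 0" "N > 0" "\<And>x. \<bar>w x\<bar> \<le> N * exp (- \<eta> * \<bar>x\<bar>)"
proof -
  have "1 / h > 0" using h by simp
  then obtain \<eta> where \<eta>: "\<eta> > 0" "integrable lborel (\<lambda>y. (cosh (\<eta> * y) - 1) * coth_kernel h y)"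
      "(LINT y|lborel. (cosh (\<eta> * y) - 1) * coth_kernel h y) \<le> 1 / h"
    by (rule coth_kernel_exp_moment[OF h])
  obtain B where B: "B > 0" "\<And>x. \<bar>w x\<bar> \<le> B" using bounded_if_tendsto_0[OF w] by metis
  \<comment> \<open>The factor exp(\<eta> R) lifts the barrier above the global bound B on all of
    |x| <= R.\<close>
  define N where "N = B * exp (\<eta> * R)"
  have N: "N > 0" using B by (simp add: N_def)
  have inn: "\<bar>w x\<bar> \<le> N * exp (- \<eta> * \<bar>x\<bar>)" if "\<bar>x\<bar> \<le> R" for x
  proof -
    have "0 \<le> \<eta> * (R - \<bar>x\<bar>)" using that \<eta>(1) by simp
    then have "1 \<le> exp (\<eta> * R) * exp (- \<eta> * \<bar>x\<bar>)" by (simp add: algebra_simps flip: exp_add)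
    then have "B * 1 \<le> B * (exp (\<eta> * R) * exp (- \<eta> * \<bar>x\<bar>))" using B(1) by (intro mult_left_mono) auto
    with B(2)[of x] show ?thesis by (simp add: N_def mult.assoc)
  qed
  have "w x \<le> N * exp (- \<eta> * \<bar>x\<bar>)" for x
    by (rule kcoth_comparison[OF h l \<eta> w f eq out N]) (use inn in \<open>auto simp: abs_le_iff\<close>)
  moreover have "- w x \<le> N * exp (- \<eta> * \<bar>x\<bar>)" for x
  proof (rule kcoth_comparison[OF h l \<eta>, where R=R and f="\<lambda>x. - f x"])
    show "((\<lambda>x. - w x) \<longlongrightarrow> 0) at_infinity" "((\<lambda>x. - f x) \<longlongrightarrow> 0) at_infinity"
      using tendsto_minus[OF w(2)] tendsto_minus[OF f(2)] by simp_all
    fix \<phi> assume "test_fun \<phi>"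
    have "(LINT x|lborel. - w x * fmult (kcoth h) \<phi> x + l * (- w x * \<phi> x)) =
        (LINT x|lborel. - (w x * fmult (kcoth h) \<phi> x + l * (w x * \<phi> x)))" by simp
    also have "\<dots> = - (LINT x|lborel. f x * \<phi> x)"
      unfolding Bochner_Integration.integral_minus eq[OF \<open>test_fun \<phi>\<close>] ..
    finally show "(LINT x|lborel. - w x * fmult (kcoth h) \<phi> x + l * (- w x * \<phi> x)) = (LINT x|lborel. - f x * \<phi> x)"
      by simp
  qed (use inn N w f out in \<open>auto simp: abs_le_iff intro: continuous_intros\<close>)
  ultimately show thesis using that[OF \<eta>(1) N] by (simp add: abs_le_iff)
qed

section \<open>The coupled system\<close>

lemma integrable_mult_fmult_kcoth:
  assumes "continuous_on UNIV w" "\<And>x. \<bar>w x\<bar> \<le> B" "test_fun \<phi>" "h > 0"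
  shows "integrable lborel (\<lambda>x. w x * fmult (kcoth h) \<phi> x)"
  using mollify_kcoth(1)[OF assms(1,2) test_fun_reflect[OF assms(3), of 0] assms(4), of 0] by simp

theorem theorem7p2:
  fixes \<gamma> \<beta> \<mu> \<epsilon> M0 :: real
    and \<delta>0 :: "real \<Rightarrow> real"
    and \<xi> \<nu> :: "real \<Rightarrow> real \<Rightarrow> real \<Rightarrow> real"
    and \<xi>0 \<nu>0 :: "real \<Rightarrow> real"
  assumes "0 < \<gamma>" "\<gamma> < 1" "1 < \<beta>" "0 < \<mu>" "0 < \<epsilon>" "0 < M0"
    and nu0_H1: "H1 \<nu>0"
    and nu0_even: "\<forall>x. \<nu>0 (- x) = \<nu>0 x"
    and nu0_pos: "\<forall>x. 0 < \<nu>0 x"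
    and nu0_eq: "\<forall>\<phi>. test_fun \<phi> \<longrightarrow>
        (LINT x|lborel. \<nu>0 x * fmult (symL \<beta> \<gamma> \<mu>) \<phi> x)
          = (LINT x|lborel. \<epsilon>\<^sup>2 / (2 * \<gamma>\<^sup>2 * (1 - \<gamma>)) * (\<nu>0 x) ^ 3 * \<phi> x)"
    and xi0_def: "\<forall>x. \<xi>0 x = \<epsilon> / (2 * \<gamma> * (1 - \<gamma>)) * (\<nu>0 x)\<^sup>2"
    and delta_pos: "\<forall>\<mu>\<^sub>2 \<ge> M0. 0 < \<delta>0 \<mu>\<^sub>2"
    and sol_H1: "\<forall>\<mu>\<^sub>2 \<ge> M0. \<forall>c. \<bar>c\<bar> < \<delta>0 \<mu>\<^sub>2 \<longrightarrow> H1 (\<xi> \<mu>\<^sub>2 c) \<and> H1 (\<nu> \<mu>\<^sub>2 c)"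
    and sol_cont: "\<forall>\<mu>\<^sub>2 \<ge> M0. \<forall>c. \<bar>c\<bar> < \<delta>0 \<mu>\<^sub>2 \<longrightarrow>
        continuous_on UNIV (\<xi> \<mu>\<^sub>2 c) \<and> continuous_on UNIV (\<nu> \<mu>\<^sub>2 c)"
    and sol_even: "\<forall>\<mu>\<^sub>2 \<ge> M0. \<forall>c. \<bar>c\<bar> < \<delta>0 \<mu>\<^sub>2 \<longrightarrow>
        (\<forall>x. \<xi> \<mu>\<^sub>2 c (- x) = \<xi> \<mu>\<^sub>2 c x \<and> \<nu> \<mu>\<^sub>2 c (- x) = \<nu> \<mu>\<^sub>2 c x)"
    and sol_eq1: "\<forall>\<mu>\<^sub>2 \<ge> M0. \<forall>c. \<bar>c\<bar> < \<delta>0 \<mu>\<^sub>2 \<longrightarrow> (\<forall>\<phi>. test_fun \<phi> \<longrightarrow>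
        (LINT x|lborel. - c * \<xi> \<mu>\<^sub>2 c x * fmult (symW \<beta> \<gamma> \<mu> \<mu>\<^sub>2) \<phi> x
                        + \<nu> \<mu>\<^sub>2 c x * fmult (symZ \<beta> \<gamma> \<mu> \<mu>\<^sub>2) \<phi> x)
          = (LINT x|lborel. \<epsilon> / \<gamma> * \<xi> \<mu>\<^sub>2 c x * \<nu> \<mu>\<^sub>2 c x * \<phi> x))"
    and sol_eq2: "\<forall>\<mu>\<^sub>2 \<ge> M0. \<forall>c. \<bar>c\<bar> < \<delta>0 \<mu>\<^sub>2 \<longrightarrow>
        (\<forall>x. \<xi> \<mu>\<^sub>2 c x = 1 / (1 - \<gamma>) * (c * \<nu> \<mu>\<^sub>2 c x + \<epsilon> / (2 * \<gamma>) * (\<nu> \<mu>\<^sub>2 c x)\<^sup>2))"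
    and sol_smooth: "\<forall>\<mu>\<^sub>2 \<ge> M0. h1_smooth (\<delta>0 \<mu>\<^sub>2) (\<xi> \<mu>\<^sub>2) \<and> h1_smooth (\<delta>0 \<mu>\<^sub>2) (\<nu> \<mu>\<^sub>2)"
    and sol0_lim: "((\<lambda>\<mu>\<^sub>2. h1norm (\<lambda>x. \<xi> \<mu>\<^sub>2 0 x - \<xi>0 x) + h1norm (\<lambda>x. \<nu> \<mu>\<^sub>2 0 x - \<nu>0 x))
                     \<longlongrightarrow> 0) at_top"
  shows "\<exists>M. \<forall>\<mu>\<^sub>2 \<ge> M. \<exists>\<delta>>0. \<forall>c. \<bar>c\<bar> < \<delta> \<longrightarrow>
           (\<exists>\<eta>1>0. \<exists>N1>0. \<forall>x. exp (\<eta>1 * \<bar>x\<bar>) * \<bar>\<xi> \<mu>\<^sub>2 c x\<bar> \<le> N1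
                              \<and> exp (\<eta>1 * \<bar>x\<bar>) * \<bar>\<nu> \<mu>\<^sub>2 c x\<bar> \<le> N1)"
proof (rule exI[of _ M0], intro allI impI)
  fix \<mu>\<^sub>2 assume \<mu>\<^sub>2: "M0 \<le> \<mu>\<^sub>2"
  define h where "h = sqrt \<mu>\<^sub>2"
  define a where "a = \<beta> / \<gamma> * sqrt \<mu>"
  define b where "b = (\<beta> - 1) / \<gamma> * sqrt \<mu>"
  \<comment> \<open>Chosen so that \<open>c\<^sup>2 * K < 1 / (2 * \<gamma>)\<close> is exactly the
    inequality \<open>DA\<close> below: the first summand comes from f, the second from the loss
    that c inflicts on the leading coefficient of w.\<close>
  define K where "K = (\<bar>1 - a / b\<bar> + a / (2 * b)) / (1 - \<gamma>)"
  have h: "h > 0" using assms(6) \<mu>\<^sub>2 by (simp add: h_def)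
  have a: "a > 0" and b: "b > 0" using assms(1-4) by (simp_all add: a_def b_def)
  have K: "K > 0" unfolding K_def using a b assms(2) by (intro divide_pos_pos add_nonneg_pos) auto
  define \<delta> where "\<delta> = min (\<delta>0 \<mu>\<^sub>2) (sqrt (1 / (2 * \<gamma> * K)))"
  have "\<delta> > 0" using delta_pos \<mu>\<^sub>2 K assms(1) by (simp add: \<delta>_def)
  moreover have "\<exists>\<eta>1>0. \<exists>N1>0. \<forall>x. exp (\<eta>1 * \<bar>x\<bar>) * \<bar>\<xi> \<mu>\<^sub>2 c x\<bar> \<le> N1 \<and> exp (\<eta>1 * \<bar>x\<bar>) * \<bar>\<nu> \<mu>\<^sub>2 c x\<bar> \<le> N1"
    if c: "\<bar>c\<bar> < \<delta>" for c
  proof -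
    define X where "X = \<xi> \<mu>\<^sub>2 c"
    define V where "V = \<nu> \<mu>\<^sub>2 c"
    have c': "\<bar>c\<bar> < \<delta>0 \<mu>\<^sub>2" using c by (simp add: \<delta>_def)
    have V: "continuous_on UNIV V" "(V \<longlongrightarrow> 0) at_infinity"
      using sol_cont sol_H1 \<mu>\<^sub>2 c' H1_tendsto_0[of V] unfolding V_def by blast+
    \<comment> \<open>The algebraic equation reads \<xi> = q \<nu>, with q tending to c / (1 -
      \<gamma>). The system thus becomes scalar: w = p \<nu> and f = g \<nu>, and comparing f with w
      reduces to comparing the coefficients.\<close>
    define q where "q = (\<lambda>x. (c + \<epsilon> / (2 * \<gamma>) * V x) / (1 - \<gamma>))"
    have X: "X x = q x * V x" for x
      using sol_eq2 \<mu>\<^sub>2 c' by (simp add: X_def V_def q_def power2_eq_square algebra_simps add_divide_distrib)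
    have qc: "continuous_on UNIV q"
      unfolding q_def using assms(2) by (intro continuous_intros V) auto
    have ql: "(q \<longlongrightarrow> c / (1 - \<gamma>)) at_infinity"
    proof -
      have "(q \<longlongrightarrow> (c + \<epsilon> / (2 * \<gamma>) * 0) / (1 - \<gamma>)) at_infinity"
        unfolding q_def using assms(2) by (intro tendsto_intros V) auto
      then show ?thesis by simp
    qed
    define p where "p = (\<lambda>x. b / \<gamma> - c * a * q x)"
    define g where "g = (\<lambda>x. (\<epsilon> / \<gamma> * V x + c * (1 - a / b)) * q x)"
    \<comment> \<open>A and D are the limits of the coefficients p and g at infinity.\<close>
    define A where "A = b / \<gamma> - c * a * (c / (1 - \<gamma>))"
    define D where "D = (\<epsilon> / \<gamma> * 0 + c * (1 - a / b)) * (c / (1 - \<gamma>))"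
    have pl: "(p \<longlongrightarrow> A) at_infinity" unfolding p_def A_def by (intro tendsto_intros ql)
    have gl: "(g \<longlongrightarrow> D) at_infinity" unfolding g_def D_def by (intro tendsto_intros ql V)
    have DA: "\<bar>D\<bar> < 1 / b / 2 * A"
    proof -
      have "\<bar>c\<bar>\<^sup>2 < (sqrt (1 / (2 * \<gamma> * K)))\<^sup>2"
        using c by (intro power_strict_mono) (auto simp: \<delta>_def)
      then have "c\<^sup>2 * K < 1 / (2 * \<gamma>)" using K assms(1) by (simp add: field_simps)
      moreover have "c\<^sup>2 * K = \<bar>D\<bar> + c * a * (c / (1 - \<gamma>)) / (2 * b)"
      proof -
        have "D = c\<^sup>2 * ((1 - a / b) / (1 - \<gamma>))" by (simp add: D_def power2_eq_square)
        then have "\<bar>D\<bar> = c\<^sup>2 * (\<bar>1 - a / b\<bar> / (1 - \<gamma>))" using assms(2) by (simp add: abs_mult)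
        moreover have "c * a * (c / (1 - \<gamma>)) / (2 * b) = c\<^sup>2 * (a / (2 * b) / (1 - \<gamma>))"
          by (simp only: times_divide_eq_right times_divide_eq_left divide_divide_eq_left power2_eq_square mult_ac)
        ultimately show ?thesis by (simp only: K_def add_divide_distrib distrib_left)
      qed
      moreover have "1 / b / 2 * A = 1 / (2 * \<gamma>) - c * a * (c / (1 - \<gamma>)) / (2 * b)"
        using b by (simp add: A_def right_diff_distrib) (simp add: algebra_simps)
      ultimately show ?thesis by linarith
    qed
    moreover have "0 < 1 / b / 2" using b by simp
    ultimately have A: "A > 0" by (metis abs_ge_zero le_less_trans zero_less_mult_pos)
    \<comment> \<open>The strict inequality between the limits persists far out and gives the
      smallness of f with l = 1 / b; the lower bound p >= A / 2 lets \<nu> be recovered from w at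
      the end.\<close>
    have "((\<lambda>x. 1 / b / 2 * \<bar>p x\<bar> - \<bar>g x\<bar>) \<longlongrightarrow> 1 / b / 2 * \<bar>A\<bar> - \<bar>D\<bar>) at_infinity"
      by (intro tendsto_intros pl gl)
    then have "\<forall>\<^sub>F x in at_infinity. 0 < 1 / b / 2 * \<bar>p x\<bar> - \<bar>g x\<bar>"
      by (rule order_tendstoD(1)) (use DA A in auto)
    moreover have "\<forall>\<^sub>F x in at_infinity. A / 2 < p x"
      by (rule order_tendstoD(1)[OF pl]) (use A in auto)
    ultimately have "\<forall>\<^sub>F x in at_infinity. \<bar>g x\<bar> \<le> 1 / b / 2 * \<bar>p x\<bar> \<and> A / 2 \<le> \<bar>p x\<bar>"
      by eventually_elim auto
    then obtain R where R: "\<And>x. R \<le> \<bar>x\<bar> \<Longrightarrow> \<bar>g x\<bar> \<le> 1 / b / 2 * \<bar>p x\<bar>" "\<And>x. R \<le> \<bar>x\<bar> \<Longrightarrow> A / 2 \<le> \<bar>p x\<bar>"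
      unfolding eventually_at_infinity by auto
    define w where "w = (\<lambda>x. p x * V x)"
    define f where "f = (\<lambda>x. g x * V x)"
    have w: "continuous_on UNIV w" "(w \<longlongrightarrow> 0) at_infinity"
    proof -
      show "continuous_on UNIV w"
        unfolding w_def p_def using assms(1) by (intro continuous_intros qc V) auto
      show "(w \<longlongrightarrow> 0) at_infinity"
        using tendsto_mult[OF pl V(2)] by (simp add: w_def)
    qed
    have f: "continuous_on UNIV f" "(f \<longlongrightarrow> 0) at_infinity"
    proof -
      show "continuous_on UNIV f"
        unfolding f_def g_def using assms(1) by (intro continuous_intros qc V) auto
      show "(f \<longlongrightarrow> 0) at_infinity"
        using tendsto_mult[OF gl V(2)] by (simp add: f_def)
    qed
    have Xc: "continuous_on UNIV X" using sol_cont \<mu>\<^sub>2 c' by (simp add: X_def)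
    obtain Bw where Bw: "\<And>x. \<bar>w x\<bar> \<le> Bw" using bounded_if_tendsto_0[OF w] by metis
    have eq: "(LINT x|lborel. w x * fmult (kcoth h) \<phi> x + 1 / b * (w x * \<phi> x)) = (LINT x|lborel. f x * \<phi> x)"
      if \<phi>: "test_fun \<phi>" for \<phi>
    proof -
      have W: "fmult (symW \<beta> \<gamma> \<mu> \<mu>\<^sub>2) \<phi> x = \<phi> x + a * fmult (kcoth h) \<phi> x" for x
        using fmult_affine_kcoth[OF \<phi> h, of 1 a x] by (simp add: symW_def[abs_def] a_def h_def)
      have "symZ \<beta> \<gamma> \<mu> \<mu>\<^sub>2 = (\<lambda>k. 1 / \<gamma> + b / \<gamma> * kcoth h k)"
        using assms(1) by (simp add: fun_eq_iff symZ_def b_def h_def field_simps)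
      then have Z: "fmult (symZ \<beta> \<gamma> \<mu> \<mu>\<^sub>2) \<phi> x = 1 / \<gamma> * \<phi> x + b / \<gamma> * fmult (kcoth h) \<phi> x" for x
        using fmult_affine_kcoth[OF \<phi> h, of "1 / \<gamma>" "b / \<gamma>" x] by simp
      \<comment> \<open>The term w / b produces \<nu> / \<gamma> - c (a / b) \<xi>, whereas the
        equation contains \<nu> / \<gamma> - c \<xi>; the difference is the correction in \<xi>,
        moved into f.\<close>
      have pw: "- c * X x * fmult (symW \<beta> \<gamma> \<mu> \<mu>\<^sub>2) \<phi> x + V x * fmult (symZ \<beta> \<gamma> \<mu> \<mu>\<^sub>2) \<phi> x =
          (w x * fmult (kcoth h) \<phi> x + 1 / b * (w x * \<phi> x)) - c * (1 - a / b) * (X x * \<phi> x)" for x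
        unfolding W Z X w_def p_def using b assms(1) by (simp add: field_simps)
      have i: "integrable lborel (\<lambda>x. w x * fmult (kcoth h) \<phi> x + 1 / b * (w x * \<phi> x))"
        by (intro Bochner_Integration.integrable_add integrable_mult_right integrable_mult_test_fun
              integrable_mult_fmult_kcoth[OF w(1) Bw \<phi> h] w(1) \<phi>)
      have iX: "integrable lborel (\<lambda>x. c * (1 - a / b) * (X x * \<phi> x))"
        by (intro integrable_mult_right integrable_mult_test_fun Xc \<phi>)
      have VX: "continuous_on UNIV (\<lambda>x. \<epsilon> / \<gamma> * X x * V x)" by (intro continuous_intros Xc V)
      have "(LINT x|lborel. \<epsilon> / \<gamma> * X x * V x * \<phi> x) =
          (LINT x|lborel. (w x * fmult (kcoth h) \<phi> x + 1 / b * (w x * \<phi> x)) - c * (1 - a / b) * (X x * \<phi> x))"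
        using sol_eq1 \<mu>\<^sub>2 c' \<phi> unfolding pw[symmetric] by (simp add: X_def V_def)
      also have "\<dots> = (LINT x|lborel. w x * fmult (kcoth h) \<phi> x + 1 / b * (w x * \<phi> x)) - (LINT x|lborel. c * (1 - a / b) * (X x * \<phi> x))"
        by (rule Bochner_Integration.integral_diff[OF i iX])
      finally have "(LINT x|lborel. w x * fmult (kcoth h) \<phi> x + 1 / b * (w x * \<phi> x)) =
          (LINT x|lborel. \<epsilon> / \<gamma> * X x * V x * \<phi> x) + (LINT x|lborel. c * (1 - a / b) * (X x * \<phi> x))" by simp
      also have "\<dots> = (LINT x|lborel. \<epsilon> / \<gamma> * X x * V x * \<phi> x + c * (1 - a / b) * (X x * \<phi> x))"
        by (rule Bochner_Integration.integral_add[OF integrable_mult_test_fun[OF VX \<phi>] iX, symmetric])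
      also have "\<dots> = (LINT x|lborel. f x * \<phi> x)"
        by (intro Bochner_Integration.integral_cong) (simp_all add: X f_def g_def algebra_simps)
      finally show ?thesis .
    qed
    have out: "\<bar>f x\<bar> \<le> 1 / b / 2 * \<bar>w x\<bar>" if "R < \<bar>x\<bar>" for x
      using mult_right_mono[OF R(1)[of x] abs_ge_zero[of "V x"]] that by (simp add: f_def w_def abs_mult)
    have "1 / b > 0" using b by simp
    then obtain \<eta> N where \<eta>: "\<eta> > 0" and N: "N > 0" "\<And>x. \<bar>w x\<bar> \<le> N * exp (- \<eta> * \<bar>x\<bar>)"
      using kcoth_exponential_decay[OF h _ w f eq out] by blast
    obtain B where B: "B > 0" "\<And>x. \<bar>V x\<bar> \<le> B" using bounded_if_tendsto_0[OF V] by metis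
    \<comment> \<open>The first argument serves |x| >= R, where w controls \<nu>; the second serves
      the rest, where boundedness is enough.\<close>
    define N' where "N' = max (2 / A * N) (exp (\<eta> * R) * B)"
    have N'pos: "N' > 0" using A N(1) by (simp add: N'_def less_max_iff_disj)
    have VN: "exp (\<eta> * \<bar>x\<bar>) * \<bar>V x\<bar> \<le> N'" for x
    proof (cases "R \<le> \<bar>x\<bar>")
      case True
      have "A / 2 * \<bar>V x\<bar> \<le> \<bar>w x\<bar>"
        using mult_right_mono[OF R(2)[OF True] abs_ge_zero[of "V x"]] by (simp add: w_def abs_mult)
      also have "\<dots> \<le> N * exp (- \<eta> * \<bar>x\<bar>)" by (rule N(2))
      finally have "exp (\<eta> * \<bar>x\<bar>) * (A / 2 * \<bar>V x\<bar>) \<le> exp (\<eta> * \<bar>x\<bar>) * (N * exp (- \<eta> * \<bar>x\<bar>))"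
        by (intro mult_left_mono) auto
      also have "\<dots> = N" by (simp add: exp_minus field_simps)
      finally have "exp (\<eta> * \<bar>x\<bar>) * \<bar>V x\<bar> \<le> 2 / A * N" using A by (simp add: field_simps)
      then show ?thesis by (simp add: N'_def)
    next
      case False
      then have "exp (\<eta> * \<bar>x\<bar>) * \<bar>V x\<bar> \<le> exp (\<eta> * R) * B"
        using \<eta> by (intro mult_mono B(2)) auto
      then show ?thesis by (simp add: N'_def)
    qed
    define C where "C = (\<bar>c\<bar> + \<epsilon> / (2 * \<gamma>) * B) / (1 - \<gamma>)"
    have qC: "\<bar>q x\<bar> \<le> C" for x
    proof -
      have "\<bar>c + \<epsilon> / (2 * \<gamma>) * V x\<bar> \<le> \<bar>c\<bar> + \<epsilon> / (2 * \<gamma>) * \<bar>V x\<bar>"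
        using abs_triangle_ineq[of c "\<epsilon> / (2 * \<gamma>) * V x"] assms(1,5) by (simp add: abs_mult)
      also have "\<dots> \<le> \<bar>c\<bar> + \<epsilon> / (2 * \<gamma>) * B"
        using assms(1,5) by (intro add_left_mono mult_left_mono B(2)) auto
      finally show ?thesis using assms(2) by (simp add: q_def C_def divide_right_mono)
    qed
    have C: "0 \<le> C" using qC[of 0] by linarith
    have XN: "exp (\<eta> * \<bar>x\<bar>) * \<bar>X x\<bar> \<le> C * N'" for x
    proof -
      have "exp (\<eta> * \<bar>x\<bar>) * \<bar>X x\<bar> = \<bar>q x\<bar> * (exp (\<eta> * \<bar>x\<bar>) * \<bar>V x\<bar>)" by (simp add: X abs_mult)
      also have "\<dots> \<le> C * N'" using C by (intro mult_mono qC VN) auto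
      finally show ?thesis .
    qed
    have "0 \<le> C * N'" using C N'pos by simp
    \<comment> \<open>The sum dominates both bounds and stays positive even if C = 0.\<close>
    then have "exp (\<eta> * \<bar>x\<bar>) * \<bar>X x\<bar> \<le> C * N' + N'" "exp (\<eta> * \<bar>x\<bar>) * \<bar>V x\<bar> \<le> C * N' + N'" for x
      using XN[of x] VN[of x] N'pos by linarith+
    moreover have "0 < C * N' + N'" using \<open>0 \<le> C * N'\<close> N'pos by linarith
    ultimately show ?thesis using \<eta> unfolding X_def V_def by blast
  qed
  ultimately show "\<exists>\<delta>>0. \<forall>c. \<bar>c\<bar> < \<delta> \<longrightarrow> (\<exists>\<eta>1>0. \<exists>N1>0. \<forall>x. exp (\<eta>1 * \<bar>x\<bar>) * \<bar>\<xi> \<mu>\<^sub>2 c x\<bar> \<le> N1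
                              \<and> exp (\<eta>1 * \<bar>x\<bar>) * \<bar>\<nu> \<mu>\<^sub>2 c x\<bar> \<le> N1)"
    by blast
qed

end
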